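(* Let $T\in\mathbf{B}(H)$ be left-invertible and analytic. Then the following assertions are satisfied: (i) For every $n\in\mathbb{N}_0$, the sequence $\chi_{\{n\}}I_{\mathcal{E}}\colon \mathbb{N}_0\to\mathbf{B}(\mathcal{E})$ (equal to $I_{\mathcal{E}}$ at $n$ and $0$ elsewhere) is a generalized multiplier of $T$, and $\mathcal{T}^n=M_{\chi_{\{n\}}I_{\mathcal{E}}}$. (ii) If $\hat\varphi\in\mathcal{GM}(T)$, then $M_{\hat\varphi}$ commutes with $\mathcal{T}$. (iii) For all $\hat\varphi,\hat\psi\in\mathcal{GM}(T)$, the function $\hat\varphi*\hat\psi$ belongs to $\mathcal{GM}(T)$ and $M_{\hat\varphi}M_{\hat\psi}=M_{\hat\varphi*\hat\psi}$. (iv) The spaces $\mathcal{GM}(T)$ and $\mathcal{M}(T)$, endowed with the Cauchy-type multiplication $*$ (and the norm $\|\hat\varphi\|=\|M_{\hat\varphi}\|$), are Banach algebras with unit $\chi_{\{0\}}I_{\mathcal{E}}$. In addition, $\mathcal{M}(T)$ is commutative.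
   Context: $\mathbb{N}_0=\{0,1,2,\dots\}$. $H$ is a nonzero complex Hilbert space and $\mathbf{B}(H)$ is the algebra of bounded operators on it. $T\in\mathbf{B}(H)$ is left-invertible if $AT=I$ for some $A\in\mathbf{B}(H)$, and analytic if $\bigcap_{n=0}^\infty T^n(H)=\{0\}$. For left-invertible analytic $T$ put $\mathcal{E}=\ker T^*$, let $P_{\mathcal{E}}$ be the orthogonal projection of $H$ onto $\mathcal{E}$, $L=(T^*T)^{-1}T^*$ (the adjoint of the Cauchy dual $T'=T(T^*T)^{-1}$), $r=1/r(L)$ with $r(L)$ the spectral radius of $L$, and $\mathbb{D}_r=\{z\in\mathbb{C}:|z|<r\}$. For $f\in H$ let $(Uf)(z)=\sum_{n=0}^\infty (P_{\mathcal{E}}L^nf)z^n$, $z\in\mathbb{D}_r$; $U$ is an injective linear map from $H$ into the space of $\mathcal{E}$-valued analytic functions on $\mathbb{D}_r$ (Shimorin's model). $\mathcal{H}:=U(H)$ carries the inner product making $U\colon H\to\mathcal{H}$ unitary. $\mathcal{T}=UTU^*$ is the operator of multiplication by $z$ on $\mathcal{H}$. For $\boldsymbol f\in\mathcal{H}$, $\hat{\boldsymbol f}(n)=P_{\mathcal{E}}L^nU^*\boldsymbol f$ ($n\in\mathbb{N}_0$) are its Taylor coefficients. For $\hat\varphi\colon\mathbb{N}_0\to\mathbf{B}(\mathcal{E})$ and $\hat f\colon\mathbb{N}_0\to\mathcal{E}$, $(\hat\varphi*\hat f)(n)=\sum_{k=0}^n\hat\varphi(k)\hat f(n-k)$. The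 multiplication operator $M_{\hat\varphi}$ in $\mathcal{H}$ has domain consisting of those $\boldsymbol f\in\mathcal{H}$ for which there is (a necessarily unique) $\boldsymbol g\in\mathcal{H}$ with $\hat\varphi*\hat{\boldsymbol f}=\hat{\boldsymbol g}$, and $M_{\hat\varphi}\boldsymbol f=\boldsymbol g$. $\hat\varphi$ is a generalized multiplier of $T$ if the domain of $M_{\hat\varphi}$ is all of $\mathcal{H}$ (then $M_{\hat\varphi}\in\mathbf{B}(\mathcal{H})$). $\mathcal{GM}(T)$ is the linear space of all generalized multipliers of $T$, normed by $\|\hat\varphi\|=\|M_{\hat\varphi}\|$; $\mathcal{M}(T)$ is the subspace of those $\hat\varphi\in\mathcal{GM}(T)$ all of whose coefficients $\hat\varphi(n)$ are scalar multiples of $I_{\mathcal{E}}$. For $\hat\varphi,\hat\psi\colon\mathbb{N}_0\to\mathbf{B}(\mathcal{E})$, $(\hat\varphi*\hat\psi)(k)=\sum_{j=0}^k\hat\varphi(j)\hat\psi(k-j)$. *)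

theory Defs
  imports "HOL-Analysis.Analysis" "HOL-Algebra.Module"
begin

section \<open>Complex Hilbert spaces\<close>

text \<open>The inner product is linear in the first argument.\<close>

class complex_inner = real_normed_vector +
  fixes scaleC :: "complex \<Rightarrow> 'a \<Rightarrow> 'a" (infixr "*\<^sub>C" 75)
    and cinner :: "'a \<Rightarrow> 'a \<Rightarrow> complex"
  assumes scaleC_add_right: "c *\<^sub>C (x + y) = c *\<^sub>C x + c *\<^sub>C y"
    and scaleC_add_left: "(c + d) *\<^sub>C x = c *\<^sub>C x + d *\<^sub>C x"
    and scaleC_scaleC: "c *\<^sub>C (d *\<^sub>C x) = (c * d) *\<^sub>C x"
    and scaleC_one: "1 *\<^sub>C x = x"
    and scaleR_scaleC: "r *\<^sub>R x = complex_of_real r *\<^sub>C x"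
    and cinner_commute: "cinner x y = cnj (cinner y x)"
    and cinner_add_left: "cinner (x + y) z = cinner x z + cinner y z"
    and cinner_scaleC_left: "cinner (c *\<^sub>C x) y = c * cinner x y"
    and norm_cinner: "cinner x x = complex_of_real ((norm x)\<^sup>2)"

class chilbert_space = complex_inner + complete_space

section \<open>Bounded operators on a Hilbert space\<close>

definition bounded_clinear :: "('a::complex_inner \<Rightarrow> 'a) \<Rightarrow> bool" where
  "bounded_clinear A \<longleftrightarrow> bounded_linear A \<and> (\<forall>c x. A (c *\<^sub>C x) = c *\<^sub>C A x)"

definition left_invertible :: "('a::complex_inner \<Rightarrow> 'a) \<Rightarrow> bool" where
  "left_invertible T \<longleftrightarrow> (\<exists>A. bounded_clinear A \<and> A \<circ> T = id)"

definition analytic_operator :: "('a::complex_inner \<Rightarrow> 'a) \<Rightarrow> bool" where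
  "analytic_operator T \<longleftrightarrow> (\<Inter>n. range (T ^^ n)) = {0}"

definition cadjoint :: "('a::complex_inner \<Rightarrow> 'a) \<Rightarrow> 'a \<Rightarrow> 'a" where
  "cadjoint T = (THE S. \<forall>x y. cinner (T x) y = cinner x (S y))"

definition orth_proj :: "'a::complex_inner set \<Rightarrow> 'a \<Rightarrow> 'a" where
  "orth_proj E x = (THE p. p \<in> E \<and> (\<forall>e\<in>E. cinner (x - p) e = 0))"

definition spectrum :: "('a::complex_inner \<Rightarrow> 'a) \<Rightarrow> complex set" where
  "spectrum A = {w. \<not> (\<exists>B. bounded_clinear B \<and>
     B \<circ> (\<lambda>x. A x - w *\<^sub>C x) = id \<and> (\<lambda>x. A x - w *\<^sub>C x) \<circ> B = id)}"

definition spectral_radius :: "('a::complex_inner \<Rightarrow> 'a) \<Rightarrow> real" where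
  "spectral_radius A = (SUP w\<in>spectrum A. cmod w)"

section \<open>Shimorin's model\<close>

definition defect_space :: "('a::complex_inner \<Rightarrow> 'a) \<Rightarrow> 'a set" where
  "defect_space T = {x. cadjoint T x = 0}"

definition dual_left_inverse :: "('a::complex_inner \<Rightarrow> 'a) \<Rightarrow> 'a \<Rightarrow> 'a" where
  "dual_left_inverse T = inv_into UNIV (cadjoint T \<circ> T) \<circ> cadjoint T"

definition model_radius :: "('a::complex_inner \<Rightarrow> 'a) \<Rightarrow> real" where
  "model_radius T = 1 / spectral_radius (dual_left_inverse T)"

text \<open>Elements of the model space are functions on the disc; as HOL functions they are
  \<^const>\<open>undefined\<close> off the disc.\<close>

definition model_map :: "('a::complex_inner \<Rightarrow> 'a) \<Rightarrow> 'a \<Rightarrow> complex \<Rightarrow> 'a" where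
  "model_map T f = (\<lambda>z\<in>ball 0 (model_radius T).
     \<Sum>n. z ^ n *\<^sub>C orth_proj (defect_space T) ((dual_left_inverse T ^^ n) f))"

definition model_space :: "('a::complex_inner \<Rightarrow> 'a) \<Rightarrow> (complex \<Rightarrow> 'a) set" where
  "model_space T = range (model_map T)"

text \<open>Since \<^const>\<open>model_map\<close> is unitary onto the model space, its adjoint is its inverse.\<close>

definition model_map_adj :: "('a::complex_inner \<Rightarrow> 'a) \<Rightarrow> (complex \<Rightarrow> 'a) \<Rightarrow> 'a" where
  "model_map_adj T = inv_into UNIV (model_map T)"

definition model_cinner ::
  "('a::complex_inner \<Rightarrow> 'a) \<Rightarrow> (complex \<Rightarrow> 'a) \<Rightarrow> (complex \<Rightarrow> 'a) \<Rightarrow> complex" where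
  "model_cinner T F G = cinner (model_map_adj T F) (model_map_adj T G)"

definition model_norm :: "('a::complex_inner \<Rightarrow> 'a) \<Rightarrow> (complex \<Rightarrow> 'a) \<Rightarrow> real" where
  "model_norm T F = sqrt (Re (model_cinner T F F))"

definition model_operator ::
  "('a::complex_inner \<Rightarrow> 'a) \<Rightarrow> (complex \<Rightarrow> 'a) \<Rightarrow> complex \<Rightarrow> 'a" where
  "model_operator T = model_map T \<circ> T \<circ> model_map_adj T"

definition taylor_coeff ::
  "('a::complex_inner \<Rightarrow> 'a) \<Rightarrow> (complex \<Rightarrow> 'a) \<Rightarrow> nat \<Rightarrow> 'a" where
  "taylor_coeff T F n =
     orth_proj (defect_space T) ((dual_left_inverse T ^^ n) (model_map_adj T F))"

section \<open>Operator-valued sequences and multiplication operators\<close>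

text \<open>Operators on a subspace \<open>E\<close> are represented by functions that are \<^const>\<open>undefined\<close> off
  \<open>E\<close>, so that equality of functions is equality of operators.\<close>

definition bounded_ops_on :: "'a::complex_inner set \<Rightarrow> ('a \<Rightarrow> 'a) set" where
  "bounded_ops_on E = {A \<in> E \<rightarrow>\<^sub>E E.
     (\<forall>x\<in>E. \<forall>y\<in>E. A (x + y) = A x + A y) \<and>
     (\<forall>c. \<forall>x\<in>E. A (c *\<^sub>C x) = c *\<^sub>C A x) \<and>
     (\<exists>K. \<forall>x\<in>E. norm (A x) \<le> K * norm x)}"

definition chi_id :: "('a::complex_inner \<Rightarrow> 'a) \<Rightarrow> nat \<Rightarrow> nat \<Rightarrow> 'a \<Rightarrow> 'a" where
  "chi_id T n = (\<lambda>k. \<lambda>x\<in>defect_space T. if k = n then x else 0)"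

definition conv_vec ::
  "(nat \<Rightarrow> 'a \<Rightarrow> 'a) \<Rightarrow> (nat \<Rightarrow> 'a) \<Rightarrow> nat \<Rightarrow> 'a::complex_inner" where
  "conv_vec \<phi> f n = (\<Sum>k\<le>n. \<phi> k (f (n - k)))"

definition conv_op :: "('a::complex_inner \<Rightarrow> 'a) \<Rightarrow>
    (nat \<Rightarrow> 'a \<Rightarrow> 'a) \<Rightarrow> (nat \<Rightarrow> 'a \<Rightarrow> 'a) \<Rightarrow> nat \<Rightarrow> 'a \<Rightarrow> 'a" where
  "conv_op T \<phi> \<psi> k = (\<lambda>x\<in>defect_space T. \<Sum>j\<le>k. \<phi> j (\<psi> (k - j) x))"

definition mult_dom ::
  "('a::complex_inner \<Rightarrow> 'a) \<Rightarrow> (nat \<Rightarrow> 'a \<Rightarrow> 'a) \<Rightarrow> (complex \<Rightarrow> 'a) set" where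
  "mult_dom T \<phi> = {F \<in> model_space T.
     \<exists>G\<in>model_space T. conv_vec \<phi> (taylor_coeff T F) = taylor_coeff T G}"

definition mult_op :: "('a::complex_inner \<Rightarrow> 'a) \<Rightarrow>
    (nat \<Rightarrow> 'a \<Rightarrow> 'a) \<Rightarrow> (complex \<Rightarrow> 'a) \<Rightarrow> complex \<Rightarrow> 'a" where
  "mult_op T \<phi> F =
     (THE G. G \<in> model_space T \<and> conv_vec \<phi> (taylor_coeff T F) = taylor_coeff T G)"

definition gen_multipliers :: "('a::complex_inner \<Rightarrow> 'a) \<Rightarrow> (nat \<Rightarrow> 'a \<Rightarrow> 'a) set" where
  "gen_multipliers T =
     {\<phi>. (\<forall>n. \<phi> n \<in> bounded_ops_on (defect_space T)) \<and> mult_dom T \<phi> = model_space T}"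

definition scalar_multipliers :: "('a::complex_inner \<Rightarrow> 'a) \<Rightarrow> (nat \<Rightarrow> 'a \<Rightarrow> 'a) set" where
  "scalar_multipliers T =
     {\<phi> \<in> gen_multipliers T. \<forall>n. \<exists>c. \<phi> n = (\<lambda>x\<in>defect_space T. c *\<^sub>C x)}"

text \<open>The operator norm of the multiplication operator with respect to \<^const>\<open>model_norm\<close>.\<close>

definition multiplier_norm :: "('a::complex_inner \<Rightarrow> 'a) \<Rightarrow> (nat \<Rightarrow> 'a \<Rightarrow> 'a) \<Rightarrow> real" where
  "multiplier_norm T \<phi> =
     (SUP F\<in>{F \<in> model_space T. model_norm T F \<le> 1}. model_norm T (mult_op T \<phi> F))"

definition multiplier_algebra :: "('a::complex_inner \<Rightarrow> 'a) \<Rightarrow> (nat \<Rightarrow> 'a \<Rightarrow> 'a) set \<Rightarrow>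
    (complex, nat \<Rightarrow> 'a \<Rightarrow> 'a) module" where
  "multiplier_algebra T S = \<lparr>
     carrier = S,
     mult = conv_op T,
     one = chi_id T 0,
     zero = (\<lambda>n. \<lambda>x\<in>defect_space T. 0),
     add = (\<lambda>\<phi> \<psi> n. \<lambda>x\<in>defect_space T. \<phi> n x + \<psi> n x),
     smult = (\<lambda>c \<phi> n. \<lambda>x\<in>defect_space T. c *\<^sub>C \<phi> n x)\<rparr>"

section \<open>Unital Banach algebras\<close>

definition complex_ring :: "complex ring" where
  "complex_ring = \<lparr>carrier = UNIV, mult = (*), one = 1, zero = 0, add = (+)\<rparr>"

definition unital_banach_algebra :: "(complex, 'b) module \<Rightarrow> ('b \<Rightarrow> real) \<Rightarrow> bool" where
  "unital_banach_algebra A N \<longleftrightarrow>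
     Module.module complex_ring A \<and> Ring.ring A \<and>
     (\<forall>c. \<forall>x\<in>carrier A. \<forall>y\<in>carrier A.
        (c \<odot>\<^bsub>A\<^esub> x) \<otimes>\<^bsub>A\<^esub> y = c \<odot>\<^bsub>A\<^esub> (x \<otimes>\<^bsub>A\<^esub> y) \<and>
        x \<otimes>\<^bsub>A\<^esub> (c \<odot>\<^bsub>A\<^esub> y) = c \<odot>\<^bsub>A\<^esub> (x \<otimes>\<^bsub>A\<^esub> y)) \<and>
     (\<forall>x\<in>carrier A. 0 \<le> N x \<and> (N x = 0 \<longleftrightarrow> x = \<zero>\<^bsub>A\<^esub>)) \<and>
     (\<forall>c. \<forall>x\<in>carrier A. N (c \<odot>\<^bsub>A\<^esub> x) = cmod c * N x) \<and>
     (\<forall>x\<in>carrier A. \<forall>y\<in>carrier A. N (x \<oplus>\<^bsub>A\<^esub> y) \<le> N x + N y) \<and>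
     (\<forall>x\<in>carrier A. \<forall>y\<in>carrier A. N (x \<otimes>\<^bsub>A\<^esub> y) \<le> N x * N y) \<and>
     N \<one>\<^bsub>A\<^esub> = 1 \<and>
     (\<forall>s. range s \<subseteq> carrier A \<and>
        (\<forall>e>0. \<exists>n0. \<forall>m\<ge>n0. \<forall>n\<ge>n0. N (s m \<ominus>\<^bsub>A\<^esub> s n) < e) \<longrightarrow>
        (\<exists>x\<in>carrier A. (\<lambda>n. N (s n \<ominus>\<^bsub>A\<^esub> x)) \<longlonglongrightarrow> 0))"

end

theory Submission
  imports Defs
begin

text \<open>Write L for \<open>(T\<^sup>* T)\<^sup>-\<^sup>1 T\<^sup>*\<close>. Since the projection onto the defect space E is
  \<open>I - T L\<close>, analyticity makes f determined by its coefficients \<open>P L\<^sup>n f\<close>; these are shifted by T,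
  and vanish beyond index 0 for f in E. Hence everything can be transported from the model space to H,
  where a multiplier acts as an everywhere defined operator with closed graph (each coefficient depends
  continuously on f), which is therefore bounded. A multiplier is recovered from its operator by applying
  the latter to E, so the algebra axioms follow from those for operators, and a norm limit of multiplication
  operators is the multiplication operator of the coefficientwise limit.\<close>


subsection \<open>Hilbert space preliminaries\<close>

\<comment> \<open>Elements of the model space are bare functions on a disc, so coefficients must be
  read off from values near 0, and the transport to H rests on injectivity of the model map. This is
  why spectra enter: the radius is the reciprocal of a spectral radius, a real supremum that has to
  be bounded above and positive for the disc to be nonempty. Convergence of the series is then
  established only on a possibly smaller disc, from a crude geometric bound; agreement of two model
  functions there already forces equal coefficients. The adjoint, the orthogonal projection and the
  inverse of \<open>T\<^sup>* T\<close> are given by description or choice operators, so each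
  becomes usable only through existence and uniqueness. Nearest points in closed subspaces and Riesz
  representation supply these.\<close>
subclass (in chilbert_space) banach ..

lemma scaleC_zero_left [simp]: "0 *\<^sub>C (x::'a::complex_inner) = 0"
  using scaleR_scaleC[of 0 x] by simp

lemma scaleC_zero_right [simp]: "c *\<^sub>C (0::'a::complex_inner) = 0"
  using scaleC_add_right[of c "0::'a" 0] by simp

lemma scaleC_minus_right: "c *\<^sub>C (- x) = - (c *\<^sub>C (x::'a::complex_inner))"
  using scaleC_add_right[of c x "- x"] by (simp add: eq_neg_iff_add_eq_0 add.commute)

lemma scaleC_diff_right: "c *\<^sub>C (x - y) = c *\<^sub>C x - c *\<^sub>C (y::'a::complex_inner)"
  using scaleC_add_right[of c x "- y"] by (simp add: scaleC_minus_right)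

lemma scaleC_minus_left: "(- c) *\<^sub>C x = - (c *\<^sub>C (x::'a::complex_inner))"
  using scaleC_add_left[of c "- c" x] by (simp add: eq_neg_iff_add_eq_0 add.commute)

lemma scaleC_sum_right: "c *\<^sub>C (\<Sum>i\<in>A. f i) = (\<Sum>i\<in>A. c *\<^sub>C (f i :: 'a::complex_inner))"
  by (induction A rule: infinite_finite_induct) (auto simp: scaleC_add_right)

lemma cinner_zero_left [simp]: "cinner 0 (y::'a::complex_inner) = 0"
  using cinner_add_left[of 0 0 y] by simp

lemma cinner_zero_right [simp]: "cinner (x::'a::complex_inner) 0 = 0"
  by (subst cinner_commute) simp

lemma cinner_add_right: "cinner (x::'a::complex_inner) (y + z) = cinner x y + cinner x z"
  by (subst (1 2 3) cinner_commute) (simp add: cinner_add_left)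

lemma cinner_scaleC_right: "cinner (x::'a::complex_inner) (c *\<^sub>C y) = cnj c * cinner x y"
  by (subst (1 2) cinner_commute) (simp add: cinner_scaleC_left)

lemma cinner_minus_left: "cinner (- x) (y::'a::complex_inner) = - cinner x y"
  using cinner_add_left[of x "- x" y] by (simp add: eq_neg_iff_add_eq_0 add.commute)

lemma cinner_minus_right: "cinner (x::'a::complex_inner) (- y) = - cinner x y"
  by (subst (1 2) cinner_commute) (simp add: cinner_minus_left)

lemma cinner_diff_left: "cinner (x - y) (z::'a::complex_inner) = cinner x z - cinner y z"
  using cinner_add_left[of x "- y" z] by (simp add: cinner_minus_left)

lemma cinner_diff_right: "cinner (x::'a::complex_inner) (y - z) = cinner x y - cinner x z"
  using cinner_add_right[of x y "- z"] by (simp add: cinner_minus_right)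

lemmas cinner_simps = cinner_add_left cinner_add_right cinner_diff_left cinner_diff_right
  cinner_scaleC_left cinner_scaleC_right cinner_minus_left cinner_minus_right

lemma cinner_eq_0_self [simp]: "cinner x x = 0 \<longleftrightarrow> (x::'a::complex_inner) = 0"
  by (simp add: norm_cinner)

lemma norm_scaleC: "norm (c *\<^sub>C (x::'a::complex_inner)) = cmod c * norm x"
proof -
  have "complex_of_real ((norm (c *\<^sub>C x))\<^sup>2) = (c * cnj c) * complex_of_real ((norm x)\<^sup>2)"
    by (simp add: norm_cinner[symmetric] cinner_simps mult.assoc del: of_real_power)
  also have "\<dots> = complex_of_real ((cmod c * norm x)\<^sup>2)"
    by (simp add: complex_mult_cnj cmod_power2 power_mult_distrib)
  finally have "(norm (c *\<^sub>C x))\<^sup>2 = (cmod c * norm x)\<^sup>2"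
    using of_real_eq_iff by blast
  then show ?thesis by (simp add: power2_eq_iff_nonneg)
qed

text \<open>Pythagoras for the component of x orthogonal to y. Nonnegativity of the left side yields
  the Cauchy-Schwarz inequality, and the exact decrease shows that nearest points are orthogonal
  projections.\<close>

lemma norm_sub_projection:
  fixes x y :: "'a::complex_inner"
  assumes "y \<noteq> 0"
  shows "(norm (x - (cinner x y / complex_of_real ((norm y)\<^sup>2)) *\<^sub>C y))\<^sup>2
    = (norm x)\<^sup>2 - (cmod (cinner x y))\<^sup>2 / (norm y)\<^sup>2"
proof -
  let ?n = "complex_of_real ((norm y)\<^sup>2)"
  have n: "?n \<noteq> 0" using assms by simp
  have "complex_of_real ((norm (x - (cinner x y / ?n) *\<^sub>C y))\<^sup>2)
      = cinner x x - cinner x y * cnj (cinner x y) / ?n"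
    using n unfolding norm_cinner[symmetric]
    by (simp add: cinner_simps norm_cinner[of y] cinner_commute[of y x] field_simps del: of_real_power)
  also have "\<dots> = complex_of_real ((norm x)\<^sup>2 - (cmod (cinner x y))\<^sup>2 / (norm y)\<^sup>2)"
    by (simp add: norm_cinner complex_mult_cnj cmod_power2)
  finally show ?thesis using of_real_eq_iff by blast
qed

lemma cinner_Cauchy_Schwarz: "cmod (cinner x y) \<le> norm x * norm (y::'a::complex_inner)"
proof (cases "y = 0")
  case False
  have "0 \<le> (norm x)\<^sup>2 - (cmod (cinner x y))\<^sup>2 / (norm y)\<^sup>2"
    unfolding norm_sub_projection[OF False, symmetric] by simp
  then have "(cmod (cinner x y))\<^sup>2 \<le> (norm x * norm y)\<^sup>2"
    using False by (simp add: field_simps power_mult_distrib)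
  then show ?thesis by (rule power2_le_imp_le) simp
qed simp

lemma bounded_linear_cinner_left: "bounded_linear (\<lambda>x. cinner x (y::'a::complex_inner))"
  by (rule bounded_linear_intro[where K = "norm y"])
    (auto simp: cinner_simps scaleR_scaleC cinner_Cauchy_Schwarz scaleR_conv_of_real)

lemma tendsto_cinner_left:
  "(f \<longlongrightarrow> l) F \<Longrightarrow> ((\<lambda>x. cinner (f x) (y::'a::complex_inner)) \<longlongrightarrow> cinner l y) F"
  by (rule bounded_linear.tendsto[OF bounded_linear_cinner_left])

lemma bounded_linear_scaleC_right: "bounded_linear (\<lambda>x. c *\<^sub>C (x::'a::complex_inner))"
  by (rule bounded_linear_intro[where K = "cmod c"])
    (auto simp: scaleC_add_right scaleR_scaleC scaleC_scaleC norm_scaleC mult.commute)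

lemma bounded_linear_scaleC_left: "bounded_linear (\<lambda>c. c *\<^sub>C (x::'a::complex_inner))"
  by (rule bounded_linear_intro[where K = "norm x"])
    (auto simp: scaleC_add_left scaleR_scaleC scaleC_scaleC norm_scaleC mult.commute scaleR_conv_of_real)

lemma tendsto_scaleC_right:
  "(f \<longlongrightarrow> l) F \<Longrightarrow> ((\<lambda>x. c *\<^sub>C f x) \<longlongrightarrow> c *\<^sub>C (l::'a::complex_inner)) F"
  by (rule bounded_linear.tendsto[OF bounded_linear_scaleC_right])

lemma parallelogram_law:
  "(norm (x + y))\<^sup>2 + (norm (x - y))\<^sup>2 = 2 * (norm x)\<^sup>2 + 2 * (norm (y::'a::complex_inner))\<^sup>2"
proof -
  have "complex_of_real ((norm (x + y))\<^sup>2 + (norm (x - y))\<^sup>2)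
      = complex_of_real (2 * (norm x)\<^sup>2 + 2 * (norm y)\<^sup>2)"
    by (simp add: norm_cinner[symmetric] cinner_simps del: of_real_power)
  then show ?thesis using of_real_eq_iff by blast
qed

section \<open>Nearest points, Riesz representation and adjoints\<close>

definition closed_csubspace :: "'a::complex_inner set \<Rightarrow> bool" where
  "closed_csubspace M \<longleftrightarrow> closed M \<and> 0 \<in> M \<and> (\<forall>x\<in>M. \<forall>y\<in>M. x + y \<in> M) \<and> (\<forall>c. \<forall>x\<in>M. c *\<^sub>C x \<in> M)"

text \<open>A minimizing sequence converges: two points of M that almost realize the distance have
  their midpoint in M, so the parallelogram law forces them to be close to each other.\<close>

lemma nearest_point_exists:
  fixes M :: "'a::chilbert_space set"
  assumes M: "closed_csubspace M"
  obtains p where "p \<in> M" "\<And>m. m \<in> M \<Longrightarrow> norm (x - p) \<le> norm (x - m)"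
proof -
  define d where "d = (INF m\<in>M. norm (x - m))"
  have M0: "0 \<in> M" and Mc: "closed M" using M by (auto simp: closed_csubspace_def)
  have bdd: "bdd_below ((\<lambda>m. norm (x - m)) ` M)" by (rule bdd_belowI2[where m=0]) simp
  have d_le: "d \<le> norm (x - m)" if "m \<in> M" for m
    unfolding d_def by (rule cINF_lower[OF bdd that])
  have d0: "0 \<le> d" unfolding d_def using M0 by (intro cINF_greatest) auto
  have "\<exists>m\<in>M. norm (x - m) < d + inverse (real (Suc n))" for n
  proof -
    have "(INF m\<in>M. norm (x - m)) < d + inverse (real (Suc n))" unfolding d_def by simp
    then show ?thesis using M0 bdd by (subst (asm) cINF_less_iff) auto
  qed
  then obtain s where s: "\<And>n. s n \<in> M" "\<And>n. norm (x - s n) < d + inverse (real (Suc n))" by metis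
  have lim: "(\<lambda>n. norm (x - s n)) \<longlonglongrightarrow> d"
  proof (rule tendsto_sandwich[where f = "\<lambda>_. d" and h = "\<lambda>n. d + inverse (real (Suc n))"])
    show "(\<lambda>n. d + inverse (real (Suc n))) \<longlonglongrightarrow> d"
      using tendsto_add[OF tendsto_const LIMSEQ_inverse_real_of_nat] by simp
  qed (use s d_le in \<open>auto intro!: always_eventually less_imp_le\<close>)
  \<comment> \<open>The midpoint of \<open>s m\<close> and \<open>s n\<close> has distance at least
    d from x. Inserted into the parallelogram law for \<open>x - s m\<close> and
    \<open>x - s n\<close>, this leaves only the excesses over \<open>d\<^sup>2\<close>.\<close>
  have key: "(norm (s m - s n))\<^sup>2 \<le> 2 * ((norm (x - s m))\<^sup>2 - d\<^sup>2) + 2 * ((norm (x - s n))\<^sup>2 - d\<^sup>2)" for m n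
  proof -
    have mid: "(1/2) *\<^sub>C (s m + s n) \<in> M" using M s(1) unfolding closed_csubspace_def by blast
    have "(x - s m) + (x - s n) = 2 *\<^sub>C (x - (1/2) *\<^sub>C (s m + s n))"
      using scaleC_add_left[of 1 1 x]
      by (simp add: scaleC_diff_right scaleC_scaleC scaleC_one)
    then have "norm ((x - s m) + (x - s n)) = 2 * norm (x - (1/2) *\<^sub>C (s m + s n))"
      by (simp add: norm_scaleC)
    moreover have "d \<le> norm (x - (1/2) *\<^sub>C (s m + s n))" by (rule d_le[OF mid])
    ultimately have "(2 * d)\<^sup>2 \<le> (norm ((x - s m) + (x - s n)))\<^sup>2" using d0
      by (intro power_mono) auto
    moreover have "norm ((x - s m) - (x - s n)) = norm (s m - s n)"
      by (simp add: norm_minus_commute)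
    ultimately show ?thesis using parallelogram_law[of "x - s m" "x - s n"]
      by (simp add: power_mult_distrib)
  qed
  have l0: "(\<lambda>n. 2 * ((norm (x - s n))\<^sup>2 - d\<^sup>2)) \<longlonglongrightarrow> 0"
    by (intro tendsto_mult_right_zero LIM_zero tendsto_power lim)
  have "Cauchy s"
  proof (rule CauchyI)
    fix e :: real assume e: "0 < e"
    have "\<forall>\<^sub>F n in sequentially. 2 * ((norm (x - s n))\<^sup>2 - d\<^sup>2) < e\<^sup>2 / 2"
      by (rule order_tendstoD(2)[OF l0]) (use e in simp)
    then obtain N where N: "\<And>n. n \<ge> N \<Longrightarrow> 2 * ((norm (x - s n))\<^sup>2 - d\<^sup>2) < e\<^sup>2 / 2"
      by (auto simp: eventually_sequentially)
    show "\<exists>N. \<forall>m\<ge>N. \<forall>n\<ge>N. norm (s m - s n) < e"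
    proof (intro exI allI impI)
      fix m n assume "m \<ge> N" "n \<ge> N"
      with N[of m] N[of n] key[of m n] have "(norm (s m - s n))\<^sup>2 < e\<^sup>2" by simp
      then show "norm (s m - s n) < e" using e by (simp add: power2_less_imp_less)
    qed
  qed
  then obtain p where p: "s \<longlonglongrightarrow> p" using Cauchy_convergent convergent_def by blast
  have "p \<in> M" using closed_sequentially[OF Mc _ p] s(1) by blast
  moreover have "norm (x - p) = d"
    using LIMSEQ_unique[OF tendsto_norm[OF tendsto_diff[OF tendsto_const p]] lim] .
  ultimately show thesis using that d_le by auto
qed

lemma orthogonal_decomposition:
  fixes M :: "'a::chilbert_space set"
  assumes M: "closed_csubspace M"
  obtains p where "p \<in> M" "\<And>m. m \<in> M \<Longrightarrow> cinner (x - p) m = 0"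
proof -
  obtain p where p: "p \<in> M" "\<And>m. m \<in> M \<Longrightarrow> norm (x - p) \<le> norm (x - m)"
    using nearest_point_exists[OF M] by blast
  have "cinner (x - p) m = 0" if m: "m \<in> M" for m
  proof (cases "m = 0")
    case False
    \<comment> \<open>\<open>t *\<^sub>C m\<close> is the projection of \<open>x - p\<close> onto
      the line through m. Moving p by it lowers the squared distance by
      \<open>(cmod (cinner (x - p) m))\<^sup>2 / (norm m)\<^sup>2\<close>, which minimality forces
      to be 0.\<close>
    define t where "t = cinner (x - p) m / complex_of_real ((norm m)\<^sup>2)"
    have "p + t *\<^sub>C m \<in> M" using M m p(1) unfolding closed_csubspace_def by blast
    from p(2)[OF this] have "(norm (x - p))\<^sup>2 \<le> (norm (x - p - t *\<^sub>C m))\<^sup>2"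
      by (simp add: diff_diff_eq)
    also have "\<dots> = (norm (x - p))\<^sup>2 - (cmod (cinner (x - p) m))\<^sup>2 / (norm m)\<^sup>2"
      unfolding t_def by (rule norm_sub_projection[OF False])
    finally have "(cmod (cinner (x - p) m))\<^sup>2 / (norm m)\<^sup>2 \<le> 0" by simp
    then show ?thesis using False by (simp add: divide_le_0_iff)
  qed simp
  with p(1) show thesis using that by blast
qed

lemma Riesz_representation:
  fixes \<phi> :: "'a::chilbert_space \<Rightarrow> complex"
  assumes bl: "bounded_linear \<phi>" and cl: "\<And>c x. \<phi> (c *\<^sub>C x) = c * \<phi> x"
  obtains y where "\<And>x. \<phi> x = cinner x y"
proof (cases "\<forall>x. \<phi> x = 0")
  case True
  then show ?thesis using that[of 0] by simp
next
  case False
  then obtain x0 where x0: "\<phi> x0 \<noteq> 0" by blast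
  interpret \<phi>: bounded_linear \<phi> by (rule bl)
  let ?K = "{x. \<phi> x = 0}"
  have "closed ?K" by (intro closed_Collect_eq continuous_intros \<phi>.continuous_on)
  then have "closed_csubspace ?K" by (simp add: closed_csubspace_def \<phi>.add cl \<phi>.zero)
  then obtain p where p: "p \<in> ?K" "\<And>m. m \<in> ?K \<Longrightarrow> cinner (x0 - p) m = 0"
    using orthogonal_decomposition by blast
  define u where "u = x0 - p"
  have \<phi>u: "\<phi> u \<noteq> 0" using p(1) x0 by (simp add: u_def \<phi>.diff)
  then have u0: "u \<noteq> 0" using \<phi>.zero by auto
  show ?thesis
  proof (rule that[of "cnj (\<phi> u / complex_of_real ((norm u)\<^sup>2)) *\<^sub>C u"])
    fix x
    \<comment> \<open>The combination of x and u lies in the kernel of \<phi>, to which u is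
      orthogonal; the resulting equation is solved for \<open>\<phi> x\<close>. The factor of u is
      conjugated because the inner product is conjugate-linear in its second argument.\<close>
    have "cinner u (\<phi> u *\<^sub>C x - \<phi> x *\<^sub>C u) = 0"
      unfolding u_def by (rule p(2)) (simp add: \<phi>.diff cl)
    then have "cinner (\<phi> u *\<^sub>C x - \<phi> x *\<^sub>C u) u = 0" by (subst cinner_commute) simp
    then show "\<phi> x = cinner x (cnj (\<phi> u / complex_of_real ((norm u)\<^sup>2)) *\<^sub>C u)"
      using u0 by (simp add: cinner_simps norm_cinner field_simps del: of_real_power)
  qed
qed

lemma cinner_right_eqI:
  assumes "\<And>x. cinner x y = cinner x (z::'a::complex_inner)"
  shows "y = z"
proof -
  have "cinner (y - z) (y - z) = 0" using assms[of "y - z"] by (simp add: cinner_diff_right)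
  then show ?thesis by simp
qed

text \<open>The description in \<open>cadjoint\<close> needs exactly one candidate: Riesz
  representation of \<open>\<lambda>x. cinner (T x) y\<close> gives existence, nondegeneracy of the
  inner product gives uniqueness.\<close>

lemma cinner_cadjoint:
  fixes T :: "'a::chilbert_space \<Rightarrow> 'a"
  assumes T: "bounded_clinear T"
  shows "cinner (T x) y = cinner x (cadjoint T y)"
proof -
  have bl: "bounded_linear T" and cl: "\<And>c x. T (c *\<^sub>C x) = c *\<^sub>C T x"
    using T by (auto simp: bounded_clinear_def)
  have "\<exists>z. \<forall>x. cinner (T x) y = cinner x z" for y
    using Riesz_representation[OF bounded_linear_compose[OF bounded_linear_cinner_left[of y] bl]]
    by (metis cl cinner_scaleC_left)
  then obtain S where S: "\<forall>x y. cinner (T x) y = cinner x (S y)" by metis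
  have "\<forall>x y. cinner (T x) y = cinner x (cadjoint T y)"
    unfolding cadjoint_def
  proof (rule theI[where a = S and P = "\<lambda>S. \<forall>x y. cinner (T x) y = cinner x (S y)", OF S])
    fix S' assume "\<forall>x y. cinner (T x) y = cinner x (S' y)"
    then show "S' = S" using S by (intro ext cinner_right_eqI) metis
  qed
  then show ?thesis by blast
qed

lemma orth_proj_eqI:
  fixes x p :: "'a::complex_inner"
  assumes "p \<in> E" "\<And>e. e \<in> E \<Longrightarrow> cinner (x - p) e = 0" "\<And>a b. a \<in> E \<Longrightarrow> b \<in> E \<Longrightarrow> a - b \<in> E"
  shows "orth_proj E x = p"
  unfolding orth_proj_def
proof (rule the_equality)
  show "p \<in> E \<and> (\<forall>e\<in>E. cinner (x - p) e = 0)" using assms by blast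
  fix q assume q: "q \<in> E \<and> (\<forall>e\<in>E. cinner (x - q) e = 0)"
  then have "q - p \<in> E" using assms by blast
  then have "cinner (x - p) (q - p) - cinner (x - q) (q - p) = 0" using q assms(2) by simp
  then have "cinner (q - p) (q - p) = 0" by (simp add: cinner_diff_left)
  then show "q = p" by simp
qed

subsection \<open>The closed graph theorem\<close>

text \<open>Baire's theorem makes some set of vectors with image bounded by k dense in a ball; differences and
  scaling transfer this to all of the space.\<close>

lemma approximation_with_bounded_image:
  fixes f :: "'a::banach \<Rightarrow> 'b::real_normed_vector"
  assumes lin: "linear f"
  obtains K where "0 \<le> K" "\<And>x e. 0 < e \<Longrightarrow> \<exists>y. norm (x - y) < e \<and> norm (f y) \<le> K * norm x"
proof -
  interpret f: linear f by (rule lin)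
  define C where "C k = closure {x. norm (f x) \<le> real k}" for k :: nat
  have "\<exists>k. interior (C k) \<noteq> {}"
  proof (rule ccontr)
    assume "\<not> ?thesis"
    then have "euclidean interior_of \<Union>(range C) = ({}::'a set)"
      by (intro Baire_category_alt disjI1 completely_metrizable_space_euclidean)
        (auto simp: C_def[abs_def])
    moreover have "x \<in> \<Union>(range C)" for x
    proof -
      obtain k :: nat where "norm (f x) \<le> real k" using real_arch_simple by blast
      then have "x \<in> C k" unfolding C_def by (intro subsetD[OF closure_subset]) simp
      then show ?thesis by (rule UN_I[OF UNIV_I])
    qed
    then have "\<Union>(range C) = UNIV" by blast
    ultimately show False by simp
  qed
  then obtain k x0 where "x0 \<in> interior (C k)" by blast
  then obtain d where d: "0 < d" "ball x0 d \<subseteq> C k" using mem_interior by blast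
  \<comment> \<open>Density is known only near x0. Approximating both x0 and \<open>x0 + x\<close>
    and subtracting recenters at 0, at the cost of the factor 2.\<close>
  have small: "\<exists>y. norm (x - y) < e \<and> norm (f y) \<le> 2 * real k" if x: "norm x < d" and e: "0 < e" for x e
  proof -
    have C: "x0 \<in> C k" "x0 + x \<in> C k" using d x by (auto simp: dist_norm intro!: subsetD[OF d(2)])
    obtain u where u: "norm (f u) \<le> real k" "dist u x0 < e / 2"
      using C(1) half_gt_zero[OF e] unfolding C_def closure_approachable mem_Collect_eq by blast
    obtain v where v: "norm (f v) \<le> real k" "dist v (x0 + x) < e / 2"
      using C(2) half_gt_zero[OF e] unfolding C_def closure_approachable mem_Collect_eq by blast
    note uv = u v
    have "x - (v - u) = (u - x0) - (v - (x0 + x))" by simp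
    then have "norm (x - (v - u)) < e"
      using uv norm_triangle_ineq4[of "u - x0" "v - (x0 + x)"] by (simp only: dist_norm)
    moreover have "norm (f (v - u)) \<le> 2 * real k"
      using uv norm_triangle_ineq4[of "f v" "f u"] by (simp add: f.diff)
    ultimately show ?thesis by blast
  qed
  show thesis
  proof (rule that[of "4 * real k / d"])
    show "0 \<le> 4 * real k / d" using d by simp
    fix x e assume e: "0 < (e::real)"
    show "\<exists>y. norm (x - y) < e \<and> norm (f y) \<le> 4 * real k / d * norm x"
    proof (cases "x = 0")
      case True
      then show ?thesis using e by (intro exI[of _ 0]) (simp add: f.zero)
    next
      case False
      \<comment> \<open>Scales x to norm \<open>d / 2\<close>, inside the ball of radius d. Undoing
        the scaling turns the bound \<open>2 * real k\<close> into
        \<open>4 * real k / d * norm x\<close>.\<close>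
      define t where "t = d / (2 * norm x)"
      have t: "0 < t" using d False by (simp add: t_def)
      have "norm (t *\<^sub>R x) < d" using t d False by (simp add: t_def)
      then obtain y where y: "norm (t *\<^sub>R x - y) < t * e" "norm (f y) \<le> 2 * real k"
        using small[of "t *\<^sub>R x" "t * e"] e t by auto
      have eq: "x - inverse t *\<^sub>R y = inverse t *\<^sub>R (t *\<^sub>R x - y)"
        using t by (simp add: scaleR_diff_right)
      have "norm (x - inverse t *\<^sub>R y) = norm (t *\<^sub>R x - y) / t"
        unfolding eq using t by (simp add: divide_inverse mult.commute)
      then have "norm (x - inverse t *\<^sub>R y) < e"
        using divide_strict_right_mono[OF y(1) t] t by simp
      moreover have "norm (f (inverse t *\<^sub>R y)) = norm (f y) / t"
        using t by (simp add: f.scale divide_inverse mult.commute)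
      then have "norm (f (inverse t *\<^sub>R y)) \<le> 4 * real k / d * norm x"
        using y(2) d False by (simp add: t_def field_simps)
      ultimately show ?thesis by blast
    qed
  qed
qed

text \<open>Approximating successive remainders writes x as a series whose terms have geometrically
  decaying images. Completeness of the target sums these images, and the closed graph identifies the
  sum with \<open>f x\<close>; the geometric series accounts for the factor 2 in the bound
  \<open>2 * K\<close>.\<close>

theorem closed_graph_theorem:
  fixes f :: "'a::banach \<Rightarrow> 'b::banach"
  assumes lin: "linear f"
    and closed: "\<And>X x y. X \<longlonglongrightarrow> x \<Longrightarrow> (\<lambda>n. f (X n)) \<longlonglongrightarrow> y \<Longrightarrow> f x = y"
  shows "bounded_linear f"
proof -
  interpret f: linear f by (rule lin)
  obtain K where K: "0 \<le> K" "\<And>x e. 0 < e \<Longrightarrow> \<exists>y. norm (x - y) < e \<and> norm (f y) \<le> K * norm x"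
    using approximation_with_bounded_image[OF lin] by blast
  have "norm (f x) \<le> norm x * (2 * K)" for x
  proof (cases "x = 0")
    case False
    have "\<exists>r. r 0 = x \<and> (\<forall>n. norm (r (Suc n)) < norm x * (1/2) ^ Suc n
        \<and> norm (f (r n - r (Suc n))) \<le> K * norm (r n))"
    proof -
      have "\<exists>r. \<forall>n. (n = 0 \<longrightarrow> r n = x) \<and> (norm (r (Suc n)) < norm x * (1/2) ^ Suc n
          \<and> norm (f (r n - r (Suc n))) \<le> K * norm (r n))"
      proof (rule dependent_nat_choice)
        fix u :: 'a and n
        have "0 < norm x * (1/2) ^ Suc n" using False by simp
        from K(2)[OF this, of u] obtain y where "norm (u - y) < norm x * (1/2) ^ Suc n"
          "norm (f y) \<le> K * norm u" by blast
        then show "\<exists>v. (Suc n = 0 \<longrightarrow> v = x) \<and> norm v < norm x * (1/2) ^ Suc n \<and>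
            norm (f (u - v)) \<le> K * norm u"
          by (intro exI[of _ "u - y"]) simp
      qed auto
      then show ?thesis by blast
    qed
    then obtain r where r: "r 0 = x" "\<And>n. norm (r (Suc n)) < norm x * (1/2) ^ Suc n"
      "\<And>n. norm (f (r n - r (Suc n))) \<le> K * norm (r n)" by blast
    have r_le: "norm (r n) \<le> norm x * (1/2) ^ n" for n
      using r(1) less_imp_le[OF r(2)] by (cases n) auto
    have geom: "(\<lambda>n. norm x * (1/2) ^ n) \<longlonglongrightarrow> 0"
      by (intro tendsto_mult_right_zero LIMSEQ_power_zero) simp
    have r0: "r \<longlonglongrightarrow> 0"
      by (rule tendsto_norm_zero_cancel, rule Lim_null_comparison[OF _ geom]) (use r_le in auto)
    have fb: "norm (f (r n - r (Suc n))) \<le> K * norm x * (1/2) ^ n" for n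
      using order_trans[OF r(3) mult_left_mono[OF r_le K(1)]] by (simp add: mult.assoc)
    have sb: "(\<lambda>n. K * norm x * (1/2) ^ n) sums (K * norm x * 2)"
      using sums_mult[OF geometric_sums[of "1/2::real"], of "K * norm x"] by simp
    have summ: "summable (\<lambda>n. f (r n - r (Suc n)))"
      by (rule summable_comparison_test'[OF sums_summable[OF sb]]) (use fb in auto)
    define s where "s = (\<Sum>n. f (r n - r (Suc n)))"
    \<comment> \<open>The partial sums telescope to images of \<open>x - r n\<close>, a sequence
      tending to x, which is the situation of the closed graph hypothesis.\<close>
    have part: "(\<Sum>k<n. f (r k - r (Suc k))) = f (x - r n)" for n
      by (simp add: f.sum[symmetric] sum_lessThan_telescope' r(1))
    have "(\<lambda>n. f (x - r n)) \<longlonglongrightarrow> s"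
      using summable_LIMSEQ[OF summ] by (simp add: part s_def)
    moreover have "(\<lambda>n. x - r n) \<longlonglongrightarrow> x" using tendsto_diff[OF tendsto_const r0] by simp
    ultimately have "f x = s" using closed by blast
    moreover have "norm s \<le> K * norm x * 2"
      unfolding s_def using norm_suminf_le[OF fb sums_summable[OF sb]] sums_unique[OF sb] by simp
    ultimately show ?thesis by (simp add: mult.commute mult.left_commute)
  qed (simp add: f.zero)
  then show ?thesis by (intro bounded_linear_intro[where K = "2 * K"]) (auto simp: f.add f.scale)
qed

text \<open>Once all lower coefficients vanish, \<open>x ^ n\<close> can be divided out. The
  remaining series sums to 0 at every nonzero point of the disc, while its limit at 0 is its
  constant term \<open>a n\<close>.\<close>

lemma power_series_zero_imp_coeff_zero:
  fixes a :: "nat \<Rightarrow> 'a::{real_normed_field,banach}"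
  assumes s: "0 < s" and sums: "\<And>x. norm x < s \<Longrightarrow> (\<lambda>n. a n * x ^ n) sums 0"
  shows "a n = 0"
proof (induction n rule: less_induct)
  case (less n)
  have "((\<lambda>x::'a. 0) \<longlongrightarrow> a (0 + n)) (at 0)"
  proof (rule powser_limit_0_strong[OF s])
    fix x :: 'a assume x: "x \<noteq> 0" "norm x < s"
    have "(\<Sum>i<n. a i * x ^ i) = 0" using less by simp
    then have "(\<lambda>i. a (i + n) * x ^ (i + n)) sums 0"
      using sums[OF x(2)] sums_iff_shift[of "\<lambda>i. a i * x ^ i" n 0] by simp
    show "(\<lambda>i. a (i + n) * x ^ i) sums 0"
      using sums_divide[OF \<open>(\<lambda>i. a (i + n) * x ^ (i + n)) sums 0\<close>, of "x ^ n"] x(1)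
      by (simp add: power_add)
  qed
  then show ?case using LIM_const_eq by force
qed


subsection \<open>The model map and its Taylor coefficients\<close>

lemma bounded_clinearI:
  assumes "bounded_linear A" "\<And>c x. A (c *\<^sub>C x) = c *\<^sub>C A x"
  shows "bounded_clinear A"
  using assms by (simp add: bounded_clinear_def)

lemma bounded_clinear_imp_bounded_linear: "bounded_clinear A \<Longrightarrow> bounded_linear A"
  by (simp add: bounded_clinear_def)

lemma bounded_clinear_scaleC: "bounded_clinear A \<Longrightarrow> A (c *\<^sub>C x) = c *\<^sub>C A x"
  by (simp add: bounded_clinear_def)

lemma bounded_clinear_compose:
  "bounded_clinear A \<Longrightarrow> bounded_clinear B \<Longrightarrow> bounded_clinear (\<lambda>x. A (B x))"
  by (auto simp: bounded_clinear_def intro: bounded_linear_compose)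

lemma bounded_clinear_funpow: "bounded_clinear A \<Longrightarrow> bounded_clinear (A ^^ n)"
proof (induction n)
  case 0
  then show ?case by (simp add: bounded_clinear_def id_def)
next
  case (Suc n)
  then show ?case using bounded_clinear_compose[of A "A ^^ n"] by (simp add: comp_def)
qed

text \<open>A solution is a fixed point of a contraction with constant \<open>cmod w * K\<close>. It
  serves twice: for surjectivity of \<open>A - w\<close> when w is large, and for constructing
  eigenvectors of the left inverse of T.\<close>

lemma perturbed_identity_solvable:
  fixes A :: "'a::chilbert_space \<Rightarrow> 'a"
  assumes A: "bounded_clinear A" and K: "0 \<le> K" "\<And>x. norm (A x) \<le> K * norm x" and w: "cmod w * K < 1"
  shows "\<exists>x. y + w *\<^sub>C A x = x"
proof -
  interpret A: bounded_linear A by (rule bounded_clinear_imp_bounded_linear[OF A])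
  have "\<exists>!x. y + w *\<^sub>C A x = x"
  proof (rule banach_fix_type[OF _ w], safe)
    fix u v
    have "dist (y + w *\<^sub>C A u) (y + w *\<^sub>C A v) = cmod w * norm (A (u - v))"
      by (simp add: dist_norm A.diff scaleC_diff_right[symmetric] norm_scaleC)
    also have "\<dots> \<le> cmod w * (K * norm (u - v))" by (intro mult_left_mono K) simp
    finally show "dist (y + w *\<^sub>C A u) (y + w *\<^sub>C A v) \<le> cmod w * K * dist u v"
      by (simp add: dist_norm mult.assoc)
  qed (use K in simp)
  then show ?thesis by blast
qed

text \<open>Makes the real supremum in \<open>spectral_radius\<close> meaningful. For
  \<open>K < cmod w\<close> the operator \<open>A - w\<close> is bounded below by
  \<open>cmod w - K\<close>, which gives injectivity and a bounded inverse once surjectivity is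
  known.\<close>

lemma spectrum_bound:
  fixes A :: "'a::chilbert_space \<Rightarrow> 'a"
  assumes A: "bounded_clinear A" and K: "0 \<le> K" "\<And>x. norm (A x) \<le> K * norm x"
    and w: "w \<in> spectrum A"
  shows "cmod w \<le> K"
proof (rule ccontr)
  assume "\<not> ?thesis"
  then have wK: "K < cmod w" and w0: "w \<noteq> 0" using K by auto
  interpret A: bounded_linear A by (rule bounded_clinear_imp_bounded_linear[OF A])
  let ?D = "\<lambda>x. A x - w *\<^sub>C x"
  have D_add: "?D (x + y) = ?D x + ?D y" for x y by (simp add: A.add scaleC_add_right)
  have D_scale: "?D (c *\<^sub>C x) = c *\<^sub>C ?D x" for c x
    by (simp add: bounded_clinear_scaleC[OF A] scaleC_diff_right scaleC_scaleC mult.commute)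
  have lower: "(cmod w - K) * norm x \<le> norm (?D x)" for x
    using norm_triangle_ineq2[of "w *\<^sub>C x" "A x"] K(2)[of x]
    by (simp add: norm_scaleC norm_minus_commute left_diff_distrib)
  have inj: "x = y" if "?D x = ?D y" for x y
  proof -
    have "?D (x - y) = ?D x - ?D y" by (simp add: A.diff scaleC_diff_right)
    with that have "(cmod w - K) * norm (x - y) \<le> 0" using lower[of "x - y"] by simp
    then show ?thesis using wK by (simp add: mult_le_0_iff)
  qed
  have surj: "\<exists>x. ?D x = y" for y
  proof -
    have "cmod (1 / w) * K < 1" using wK w0 by (simp add: norm_divide)
    \<comment> \<open>Division by w brings \<open>A x - w *\<^sub>C x = y\<close> into fixed-point
      form, with coefficient \<open>1 / w\<close>.\<close>
    then obtain x where "- ((1 / w) *\<^sub>C y) + (1 / w) *\<^sub>C A x = x"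
      using perturbed_identity_solvable[OF A K] by blast
    then have "w *\<^sub>C (- ((1 / w) *\<^sub>C y) + (1 / w) *\<^sub>C A x) = w *\<^sub>C x" by simp
    then show ?thesis using w0
      by (intro exI[of _ x]) (simp add: scaleC_add_right scaleC_minus_right scaleC_scaleC scaleC_one scaleC_diff_right algebra_simps)
  qed
  define B where "B = inv_into UNIV ?D"
  have DB: "?D (B y) = y" for y unfolding B_def using surj[of y] by (intro f_inv_into_f) auto
  have BD: "B (?D x) = x" for x using inj[OF DB[of "?D x"]] .
  have "bounded_clinear B"
  proof (intro bounded_clinearI bounded_linear_intro)
    show "B (x + y) = B x + B y" for x y by (rule inj) (simp only: D_add DB)
    show Bs: "B (c *\<^sub>C x) = c *\<^sub>C B x" for c x by (rule inj) (simp only: D_scale DB)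
    show "B (c *\<^sub>R x) = c *\<^sub>R B x" for c x by (simp only: scaleR_scaleC Bs)
    show "norm (B y) \<le> norm y * (1 / (cmod w - K))" for y
      using lower[of "B y"] wK unfolding DB by (simp add: field_simps)
  qed
  then have "\<exists>B. bounded_clinear B \<and> B \<circ> ?D = id \<and> ?D \<circ> B = id"
    using DB BD by (intro exI[of _ B]) (simp add: fun_eq_iff)
  then show False using w unfolding spectrum_def by blast
qed

text \<open>The Taylor coefficients as functions of the vector f rather than of its model function,
  so that they are available before the model map is known to be injective.\<close>

definition model_coef :: "('a::complex_inner \<Rightarrow> 'a) \<Rightarrow> 'a \<Rightarrow> nat \<Rightarrow> 'a" where
  "model_coef T f n = orth_proj (defect_space T) ((dual_left_inverse T ^^ n) f)"

section \<open>The defect space and the left inverse L\<close>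

locale left_invertible_analytic =
  fixes T :: "'a::chilbert_space \<Rightarrow> 'a"
  assumes nonzero: "\<exists>x::'a. x \<noteq> 0"
    and bounded: "bounded_clinear T"
    and left_inv: "left_invertible T"
    and analytic: "analytic_operator T"
begin

abbreviation "E \<equiv> defect_space T"
abbreviation "L \<equiv> dual_left_inverse T"
abbreviation "coef \<equiv> model_coef T"
abbreviation "U \<equiv> model_map T"

sublocale T: bounded_linear T by (rule bounded_clinear_imp_bounded_linear[OF bounded])

lemmas T_scaleC = bounded_clinear_scaleC[OF bounded]

lemma mem_E_iff: "y \<in> E \<longleftrightarrow> (\<forall>x. cinner (T x) y = 0)"
proof
  assume "\<forall>x. cinner (T x) y = 0"
  then have "cinner x (cadjoint T y) = cinner x 0" for x by (simp add: cinner_cadjoint[OF bounded, symmetric])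
  then show "y \<in> E" unfolding defect_space_def using cinner_right_eqI by blast
qed (simp add: defect_space_def cinner_cadjoint[OF bounded])

lemma E_zero [simp]: "0 \<in> E" and E_add: "x \<in> E \<Longrightarrow> y \<in> E \<Longrightarrow> x + y \<in> E"
  and E_diff: "x \<in> E \<Longrightarrow> y \<in> E \<Longrightarrow> x - y \<in> E" and E_scaleC: "x \<in> E \<Longrightarrow> c *\<^sub>C x \<in> E"
  by (simp_all add: mem_E_iff cinner_simps)

lemma E_sum: "(\<And>i. i \<in> I \<Longrightarrow> f i \<in> E) \<Longrightarrow> (\<Sum>i\<in>I. f i) \<in> E"
  by (induction I rule: infinite_finite_induct) (auto intro: E_add)

lemma left_inverse_obtain:
  obtains A where "bounded_clinear A" "\<And>x. A (T x) = x"
  using left_inv unfolding left_invertible_def by (metis comp_apply id_apply)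

lemma T_eq_iff [simp]: "T x = T y \<longleftrightarrow> x = y"
  using left_inverse_obtain by metis

text \<open>Needed for projecting onto the range. A bounded left inverse A gives closedness:
  \<open>X n = T (A (X n))\<close> tends to \<open>T (A l)\<close>.\<close>

lemma closed_csubspace_range: "closed_csubspace (range T)"
  unfolding closed_csubspace_def
proof (intro conjI ballI allI)
  obtain A where A: "bounded_clinear A" "\<And>x. A (T x) = x" by (rule left_inverse_obtain) blast
  interpret A: bounded_linear A by (rule bounded_clinear_imp_bounded_linear[OF A(1)])
  show "closed (range T)"
    unfolding closed_sequential_limits
  proof (intro allI impI, elim conjE)
    fix X l assume X: "\<forall>n. X n \<in> range T" and lim: "X \<longlonglongrightarrow> l"
    have "T (A (X n)) = X n" for n using X A(2) by (metis imageE)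
    then have "X \<longlonglongrightarrow> T (A l)" using T.tendsto[OF A.tendsto[OF lim]] by simp
    then show "l \<in> range T" using LIMSEQ_unique[OF lim] by blast
  qed
  show "0 \<in> range T" by (rule range_eqI[of _ _ 0]) (simp add: T.zero)
  show "x + y \<in> range T" if "x \<in> range T" "y \<in> range T" for x y
    using that by (auto simp: T.add[symmetric])
  show "c *\<^sub>C x \<in> range T" if "x \<in> range T" for c x
    using that by (auto simp: T_scaleC[symmetric])
qed

text \<open>The hypothesis is the normal equation \<open>T\<^sup>* T g = T\<^sup>* f\<close>, and
  \<open>T\<^sup>* T\<close> is injective because T is. Linearity of L and its values on the range
  of T and on \<open>E\<close> are read off from this criterion.\<close>

lemma dual_left_inverse_eqI:
  assumes "\<And>x. cinner (f - T g) (T x) = 0"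
  shows "L f = g"
proof -
  have "cinner x (cadjoint T (T g)) = cinner x (cadjoint T f)" for x
  proof -
    have "cinner (T x) (f - T g) = 0" using assms[of x] by (subst cinner_commute) simp
    then show ?thesis by (simp add: cinner_cadjoint[OF bounded, symmetric] cinner_diff_right)
  qed
  then have eq: "cadjoint T f = (cadjoint T \<circ> T) g" by (simp add: cinner_right_eqI[symmetric])
  have "inj (cadjoint T \<circ> T)"
  proof (rule injI)
    fix x y assume "(cadjoint T \<circ> T) x = (cadjoint T \<circ> T) y"
    then have "cinner (T (x - y)) (T x) = cinner (T (x - y)) (T y)"
      by (simp add: cinner_cadjoint[OF bounded])
    then have "cinner (T (x - y)) (T (x - y)) = 0"
      by (simp only: T.diff cinner_diff_right) simp
    then show "x = y" by (simp add: T.diff)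
  qed
  from inv_f_f[OF this, of g] show ?thesis
    unfolding dual_left_inverse_def comp_apply[of _ "cadjoint T" f] eq .
qed

text \<open>\<open>T (L f)\<close> is the orthogonal projection of f onto the range of T: that
  projection exists, has the form \<open>T g\<close>, and the criterion above gives
  \<open>L f = g\<close>.\<close>

lemma residual_orthogonal: "cinner (f - T (L f)) (T x) = 0"
proof -
  obtain p where p: "p \<in> range T" "\<And>m. m \<in> range T \<Longrightarrow> cinner (f - p) m = 0"
    using orthogonal_decomposition[OF closed_csubspace_range] by blast
  then obtain g where g: "p = T g" by blast
  have "L f = g" by (rule dual_left_inverse_eqI) (use p(2) g in simp)
  then show ?thesis using p(2) g by simp
qed

lemma L_T [simp]: "L (T f) = f"
  by (rule dual_left_inverse_eqI) simp

lemma L_E: "e \<in> E \<Longrightarrow> L e = 0"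
  by (rule dual_left_inverse_eqI) (subst cinner_commute, simp add: mem_E_iff T.zero)

text \<open>\<open>T L\<close> is an orthogonal projection, hence contractive, and
  \<open>L = A (T L)\<close> for any bounded left inverse A of T. So a bound for A is also one for
  L.\<close>

lemma bounded_clinear_L: "bounded_clinear L"
proof -
  obtain A where A: "bounded_clinear A" "\<And>x. A (T x) = x" by (rule left_inverse_obtain) blast
  interpret A: bounded_linear A by (rule bounded_clinear_imp_bounded_linear[OF A(1)])
  obtain K where K: "0 < K" "\<And>x. norm (A x) \<le> norm x * K" using A.pos_bounded by blast
  have proj: "norm (T (L f)) \<le> norm f" for f
  proof -
    have "cinner f (T (L f)) = cinner (T (L f)) (T (L f))"
      using residual_orthogonal[of f "L f"] by (simp add: cinner_diff_left)
    then have "cmod (cinner f (T (L f))) = norm (T (L f)) * norm (T (L f))"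
      by (simp add: norm_cinner power2_eq_square norm_mult)
    then have "norm (T (L f)) * norm (T (L f)) \<le> norm f * norm (T (L f))"
      using cinner_Cauchy_Schwarz[of f "T (L f)"] by simp
    then show ?thesis
      by (cases "T (L f) = 0") auto
  qed
  have add: "L (f + g) = L f + L g" for f g
  proof (rule dual_left_inverse_eqI)
    fix x show "cinner (f + g - T (L f + L g)) (T x) = 0"
      using residual_orthogonal[of f x] residual_orthogonal[of g x] by (simp add: T.add cinner_simps)
  qed
  have scale: "L (c *\<^sub>C f) = c *\<^sub>C L f" for c f
  proof (rule dual_left_inverse_eqI)
    fix x show "cinner (c *\<^sub>C f - T (c *\<^sub>C L f)) (T x) = 0"
      using residual_orthogonal[of f x] by (simp add: T_scaleC cinner_simps)
  qed
  show ?thesis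
  proof (intro bounded_clinearI bounded_linear_intro)
    show "norm (L f) \<le> norm f * K" for f
      using order_trans[OF K(2)[of "T (L f)"] mult_right_mono[OF proj less_imp_le[OF K(1)]]] by (simp add: A(2))
  qed (simp_all add: add scale scaleR_scaleC)
qed

sublocale L: bounded_linear L by (rule bounded_clinear_imp_bounded_linear[OF bounded_clinear_L])

lemma residual_mem_E: "f - T (L f) \<in> E"
  unfolding mem_E_iff by (subst cinner_commute) (simp add: residual_orthogonal)

lemma orth_proj_E: "orth_proj E f = f - T (L f)"
  by (rule orth_proj_eqI[OF residual_mem_E _ E_diff]) (simp_all add: mem_E_iff)

section \<open>Coefficients of a vector\<close>

lemma bounded_clinear_coef: "bounded_clinear (\<lambda>f. coef f n)"
proof -
  have "bounded_clinear (\<lambda>f. f - T (L f))"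
    by (intro bounded_clinearI bounded_linear_sub bounded_linear_ident
        bounded_linear_compose[OF T.bounded_linear_axioms L.bounded_linear_axioms])
      (simp add: bounded_clinear_scaleC[OF bounded_clinear_L] T_scaleC scaleC_diff_right)
  from bounded_clinear_compose[OF this bounded_clinear_funpow[OF bounded_clinear_L]]
  show ?thesis by (simp add: model_coef_def orth_proj_E)
qed

lemma coef_scaleC: "coef (c *\<^sub>C f) n = c *\<^sub>C coef f n"
  using bounded_clinear_coef by (rule bounded_clinear_scaleC)

lemma coef_add: "coef (f + g) n = coef f n + coef g n"
  and coef_diff: "coef (f - g) n = coef f n - coef g n"
  and coef_zero [simp]: "coef 0 n = 0"
  and tendsto_coef: "(X \<longlongrightarrow> l) F \<Longrightarrow> ((\<lambda>i. coef (X i) n) \<longlongrightarrow> coef l n) F"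
proof -
  interpret c: bounded_linear "\<lambda>f. coef f n"
    by (rule bounded_clinear_imp_bounded_linear[OF bounded_clinear_coef])
  show "coef (f + g) n = coef f n + coef g n" by (rule c.add)
  show "coef (f - g) n = coef f n - coef g n" by (rule c.diff)
  show "coef 0 n = 0" by (rule c.zero)
  show "((\<lambda>i. coef (X i) n) \<longlongrightarrow> coef l n) F" if "(X \<longlongrightarrow> l) F"
    using that by (rule c.tendsto)
qed

lemma coef_mem_E [simp]: "coef f n \<in> E"
  by (simp add: model_coef_def orth_proj_E residual_mem_E)

lemma coef_T: "coef (T f) n = (case n of 0 \<Rightarrow> 0 | Suc m \<Rightarrow> coef f m)"
proof (cases n)
  case (Suc m)
  then have "(L ^^ n) (T f) = (L ^^ m) f" by (simp only: funpow_Suc_right comp_apply L_T)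
  then show ?thesis using Suc by (simp add: model_coef_def)
qed (simp add: model_coef_def orth_proj_E)

lemma coef_funpow_T: "coef ((T ^^ n) f) m = (if n \<le> m then coef f (m - n) else 0)"
  by (induction n arbitrary: m) (auto simp: coef_T split: nat.split)

lemma coef_E: "e \<in> E \<Longrightarrow> coef e n = (if n = 0 then e else 0)"
proof (cases n)
  case (Suc m)
  assume "e \<in> E"
  moreover have "(L ^^ m) 0 = 0" by (induction m) (simp_all add: L.zero)
  ultimately show ?thesis using Suc
    by (simp add: model_coef_def funpow_Suc_right L_E orth_proj_E L.zero T.zero del: funpow.simps(2))
qed (simp add: model_coef_def orth_proj_E L_E T.zero)

text \<open>A vanishing n-th coefficient means \<open>(L ^^ n) f = T ((L ^^ Suc n) f)\<close>.
  Chaining these equations gives \<open>f = (T ^^ n) ((L ^^ n) f)\<close>, so f lies in the range of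
  every power of T.\<close>

lemma coef_eq_zero_imp_zero:
  assumes "\<And>n. coef f n = 0"
  shows "f = 0"
proof -
  have step: "(L ^^ n) f = T ((L ^^ Suc n) f)" for n
    using assms[of n] by (simp add: model_coef_def orth_proj_E)
  have "f = (T ^^ n) ((L ^^ n) f)" for n
  proof (induction n)
    case (Suc n)
    then show ?case using step[of n] by (metis comp_apply funpow_Suc_right)
  qed simp
  then have "f \<in> (\<Inter>n. range (T ^^ n))" by blast
  then show ?thesis using analytic unfolding analytic_operator_def by blast
qed

lemma coef_inject: "coef f = coef g \<longleftrightarrow> f = g"
proof
  assume "coef f = coef g"
  then show "f = g" using coef_eq_zero_imp_zero[of "f - g"] by (simp add: coef_diff)
qed simp

text \<open>Otherwise every coefficient of every vector would vanish. A nonzero vector of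
  \<open>E\<close> is the seed of the eigenvectors of L and later recovers the scalar from a
  multiple of the identity on \<open>E\<close>.\<close>

lemma E_nontrivial: "\<exists>e\<in>E. e \<noteq> 0"
proof (rule ccontr)
  assume "\<not> ?thesis"
  then have "coef f n = 0" for f n using coef_mem_E by blast
  then show False using nonzero coef_eq_zero_imp_zero by blast
qed

text \<open>The n-th coefficient of f is the 0-th one of \<open>(L ^^ n) f\<close>, and K is a norm
  bound for L. The disc of radius \<open>1 / K\<close> may be smaller than that of the model, but
  comparing coefficients takes place near 0.\<close>

lemma coef_geometric_bound:
  obtains C K where "0 < C" "0 < K" "\<And>f n. norm (coef f n) \<le> C * K ^ n * norm f"
proof -
  interpret P: bounded_linear "\<lambda>f. coef f 0"
    by (rule bounded_clinear_imp_bounded_linear[OF bounded_clinear_coef])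
  obtain C where C: "0 < C" "\<And>f. norm (coef f 0) \<le> norm f * C" using P.pos_bounded by blast
  obtain K where K: "0 < K" "\<And>f. norm (L f) \<le> norm f * K" using L.pos_bounded by blast
  have pow: "norm ((L ^^ n) f) \<le> K ^ n * norm f" for n f
  proof (induction n)
    case (Suc n)
    have "norm (L ((L ^^ n) f)) \<le> norm ((L ^^ n) f) * K" by (rule K(2))
    also have "\<dots> \<le> (K ^ n * norm f) * K" using Suc K(1) by (intro mult_right_mono) auto
    finally show ?case by (simp add: mult_ac)
  qed simp
  have "norm (coef f n) \<le> C * K ^ n * norm f" for f n
  proof -
    have "coef f n = coef ((L ^^ n) f) 0" by (simp add: model_coef_def)
    also have "norm \<dots> \<le> norm ((L ^^ n) f) * C" by (rule C(2))
    also have "\<dots> \<le> (K ^ n * norm f) * C" using pow C(1) by (intro mult_right_mono) auto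
    finally show ?thesis by (simp add: mult_ac)
  qed
  then show thesis using that C K by blast
qed

text \<open>Every w near 0 is an eigenvalue of L: for nonzero e in the defect space the vector
  \<open>(I - w T)\<^sup>-\<^sup>1 e\<close> is an eigenvector.  Without a nonzero point in the spectrum the disc
  would have radius \<open>1 / 0 = 0\<close>.\<close>

lemma model_radius_pos: "0 < model_radius T"
proof -
  obtain e where e: "e \<in> E" "e \<noteq> 0" using E_nontrivial by blast
  obtain K where K: "0 < K" "\<And>x. norm (T x) \<le> norm x * K" using T.pos_bounded by blast
  \<comment> \<open>Chosen so that \<open>cmod w * K\<close> is \<open>1 / 2\<close>, which makes
    the perturbed identity solvable, while w stays nonzero.\<close>
  define w where "w = complex_of_real (1 / (2 * K))"
  have w: "cmod w * K < 1" "cmod w > 0" using K(1) by (auto simp: w_def norm_divide norm_mult)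
  obtain x where x: "e + w *\<^sub>C T x = x"
    using perturbed_identity_solvable[OF bounded less_imp_le[OF K(1)] _ w(1)] K(2)
    by (metis mult.commute)
  have x0: "x \<noteq> 0" using x e(2) T.zero by auto
  \<comment> \<open>L annihilates e and undoes T, so applying it to
    \<open>x = e + w *\<^sub>C T x\<close> leaves \<open>w *\<^sub>C x\<close>.\<close>
  have "L x = L e + w *\<^sub>C L (T x)"
    by (subst x[symmetric]) (simp add: L.add bounded_clinear_scaleC[OF bounded_clinear_L])
  then have Lx: "L x - w *\<^sub>C x = 0" by (simp add: L_E[OF e(1)])
  have "w \<in> spectrum L"
    unfolding spectrum_def
  proof (safe)
    fix B assume B: "bounded_clinear B" "B \<circ> (\<lambda>x. L x - w *\<^sub>C x) = id"
    have "x = B 0" using fun_cong[OF B(2), of x] Lx by simp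
    also have "B 0 = 0" using bounded_clinear_imp_bounded_linear[OF B(1)] by (simp add: linear_simps)
    finally show False using x0 by simp
  qed
  \<comment> \<open>Only with an upper bound does \<open>SUP\<close> over a set of reals dominate
    its members.\<close>
  moreover have "bdd_above (cmod ` spectrum L)"
  proof -
    obtain K' where K': "0 < K'" "\<And>x. norm (L x) \<le> norm x * K'" using L.pos_bounded by blast
    show ?thesis
      by (rule bdd_aboveI2[where M = K'], rule spectrum_bound[OF bounded_clinear_L])
        (use K' in \<open>auto simp: mult.commute less_imp_le\<close>)
  qed
  ultimately have "cmod w \<le> spectral_radius L" unfolding spectral_radius_def by (rule cSUP_upper)
  with w(2) have "0 < spectral_radius L" by linarith
  then show ?thesis by (simp add: model_radius_def)
qed

text \<open>Equal model functions have equal sums at each point of the disc. Near 0 both series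
  converge, so the series of differences has sum 0 there and its coefficients vanish.\<close>

lemma inj_model_map: "inj U"
proof (rule injI)
  fix f g assume eq: "U f = U g"
  obtain C K where CK: "0 < C" "0 < K" "\<And>f n. norm (coef f n) \<le> C * K ^ n * norm f"
    using coef_geometric_bound by blast
  \<comment> \<open>The first bound keeps z in the disc on which \<open>U f\<close> is given by the
    series; the second makes \<open>cmod z * K\<close> at most \<open>1 / 2\<close>, for comparison
    with a geometric series.\<close>
  define s where "s = min (model_radius T) (1 / (2 * K))"
  have s: "0 < s" using model_radius_pos CK by (simp add: s_def)
  have summ: "summable (\<lambda>n. z ^ n *\<^sub>C coef h n)" if z: "cmod z < s" for z h
  proof (rule summable_comparison_test')
    show "summable (\<lambda>n. C * norm h * (1/2) ^ n)" by (intro summable_mult summable_geometric) simp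
    fix n
    have "cmod z * K \<le> 1/2" using z CK(2) by (simp add: s_def field_simps)
    then have "(cmod z * K) ^ n \<le> (1/2) ^ n" using CK by (intro power_mono) auto
    have "norm (z ^ n *\<^sub>C coef h n) \<le> cmod z ^ n * (C * K ^ n * norm h)"
      by (simp add: norm_scaleC norm_power mult_left_mono CK(3))
    also have "\<dots> = C * norm h * (cmod z * K) ^ n" by (simp add: power_mult_distrib mult_ac)
    also have "\<dots> \<le> C * norm h * (1/2) ^ n" 
      using \<open>(cmod z * K) ^ n \<le> (1/2) ^ n\<close> CK(1) by (intro mult_left_mono) auto
    finally show "norm (z ^ n *\<^sub>C coef h n) \<le> C * norm h * (1/2) ^ n" .
  qed
  have "f - g = 0"
  proof (rule coef_eq_zero_imp_zero)
    fix k
    let ?d = "coef (f - g)"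
    \<comment> \<open>Pairing with the fixed vector \<open>?d k\<close> turns the vector-valued
      series into a scalar one whose k-th coefficient is the squared norm of
      \<open>?d k\<close>.\<close>
    have "cinner (?d k) (?d k) = 0"
    proof (rule power_series_zero_imp_coeff_zero[where a = "\<lambda>n. cinner (?d n) (?d k)", OF s])
      fix z :: complex assume z: "norm z < s"
      then have "z \<in> ball 0 (model_radius T)" by (simp add: s_def)
      then have "(\<Sum>n. z ^ n *\<^sub>C coef f n) = (\<Sum>n. z ^ n *\<^sub>C coef g n)"
        using fun_cong[OF eq, of z] by (simp add: model_map_def model_coef_def)
      then have "(\<lambda>n. z ^ n *\<^sub>C coef f n - z ^ n *\<^sub>C coef g n) sums 0"
        using sums_diff[OF summable_sums[OF summ[OF z]] summable_sums[OF summ[OF z]], of f g] by simp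
      then have "(\<lambda>n. z ^ n *\<^sub>C ?d n) sums 0" by (simp add: coef_diff scaleC_diff_right)
      from bounded_linear.sums[OF bounded_linear_cinner_left this, of "?d k"]
      show "(\<lambda>n. cinner (?d n) (?d k) * z ^ n) sums 0"
        by (simp add: cinner_scaleC_left mult.commute)
    qed
    then show "?d k = 0" by simp
  qed
  then show "f = g" by simp
qed

lemma model_map_adj_map [simp]: "model_map_adj T (U f) = f"
  by (simp add: model_map_adj_def inj_model_map)

lemma taylor_coeff_model_map [simp]: "taylor_coeff T (U f) = coef f"
  by (rule ext) (simp add: taylor_coeff_def model_coef_def)

lemma model_map_mem [simp]: "U f \<in> model_space T"
  by (simp add: model_space_def)

lemma model_norm_model_map [simp]: "model_norm T (U f) = norm f"
  by (simp add: model_norm_def model_cinner_def norm_cinner del: of_real_power)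

lemma model_operator_model_map [simp]: "model_operator T (U f) = U (T f)"
  by (simp add: model_operator_def)

lemma model_operator_funpow_model_map: "(model_operator T ^^ n) (U f) = U ((T ^^ n) f)"
  by (induction n) simp_all

end


subsection \<open>Generalized multipliers\<close>

text \<open>\<open>onorm\<close> is a supremum of quotients over all vectors, whereas
  \<open>multiplier_norm\<close> runs over the closed unit ball; this bridges the two.\<close>

lemma onorm_eq_SUP_unit_ball:
  fixes f :: "'a::real_normed_vector \<Rightarrow> 'b::real_normed_vector"
  assumes f: "bounded_linear f"
  shows "onorm f = (SUP x\<in>{x. norm x \<le> 1}. norm (f x))" (is "_ = ?S")
proof (rule antisym)
  interpret f: bounded_linear f by (rule f)
  have le: "norm (f x) \<le> onorm f" if "norm x \<le> 1" for x
    using order_trans[OF onorm[OF f] mult_left_mono[OF that onorm_pos_le[OF f]]] by simp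
  have bdd: "bdd_above ((\<lambda>x. norm (f x)) ` {x. norm x \<le> 1})"
    by (rule bdd_aboveI2[where M = "onorm f"]) (use le in simp)
  have S: "norm (f x) \<le> ?S" if "norm x \<le> 1" for x
    by (rule cSUP_upper[OF _ bdd]) (use that in simp)
  show "onorm f \<le> ?S"
  proof (rule onorm_bound)
    show "0 \<le> ?S" using S[of 0] by (simp add: f.zero)
    show "norm (f x) \<le> ?S * norm x" for x
    proof (cases "x = 0")
      case False
      then show ?thesis using S[of "(1 / norm x) *\<^sub>R x"] by (simp add: f.scale divide_le_eq)
    qed (simp add: f.zero)
  qed
  show "?S \<le> onorm f" by (rule cSUP_least) (use le in \<open>auto intro: exI[of _ 0]\<close>)
qed

context left_invertible_analytic
begin

text \<open>The multiplication operator conjugated back to H by the model map. The description is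
  unambiguous because a vector is determined by its coefficients.\<close>

definition mult_on_H :: "(nat \<Rightarrow> 'a \<Rightarrow> 'a) \<Rightarrow> 'a \<Rightarrow> 'a" where
  "mult_on_H \<phi> f = (THE g. coef g = conv_vec \<phi> (coef f))"

lemma mult_on_H_eqI: "coef g = conv_vec \<phi> (coef f) \<Longrightarrow> mult_on_H \<phi> f = g"
  unfolding mult_on_H_def by (rule the_equality) (auto simp: coef_inject[symmetric])

lemma gen_multipliers_iff:
  "\<phi> \<in> gen_multipliers T \<longleftrightarrow>
    (\<forall>n. \<phi> n \<in> bounded_ops_on E) \<and> (\<forall>f. \<exists>g. coef g = conv_vec \<phi> (coef f))"
proof -
  have "mult_dom T \<phi> = model_space T \<longleftrightarrow>
      (\<forall>F\<in>model_space T. \<exists>G\<in>model_space T. conv_vec \<phi> (taylor_coeff T F) = taylor_coeff T G)"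
    unfolding mult_dom_def by blast
  also have "\<dots> \<longleftrightarrow> (\<forall>f. \<exists>g. conv_vec \<phi> (coef f) = coef g)"
    by (simp add: model_space_def)
  finally have "mult_dom T \<phi> = model_space T \<longleftrightarrow> (\<forall>f. \<exists>g. conv_vec \<phi> (coef f) = coef g)" .
  then show ?thesis by (simp add: gen_multipliers_def eq_commute)
qed

lemma coef_mult_on_H:
  assumes "\<phi> \<in> gen_multipliers T"
  shows "coef (mult_on_H \<phi> f) = conv_vec \<phi> (coef f)"
  using assms mult_on_H_eqI unfolding gen_multipliers_iff by metis

lemma mult_op_model_map:
  assumes "\<phi> \<in> gen_multipliers T"
  shows "mult_op T \<phi> (U f) = U (mult_on_H \<phi> f)"
  unfolding mult_op_def taylor_coeff_model_map
proof (rule the_equality)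
  show "U (mult_on_H \<phi> f) \<in> model_space T \<and> conv_vec \<phi> (coef f) = taylor_coeff T (U (mult_on_H \<phi> f))"
    by (simp add: coef_mult_on_H[OF assms])
  fix G assume "G \<in> model_space T \<and> conv_vec \<phi> (coef f) = taylor_coeff T G"
  then obtain g where g: "G = U g" "conv_vec \<phi> (coef f) = coef g" by (auto simp: model_space_def)
  then show "G = U (mult_on_H \<phi> f)" using mult_on_H_eqI[of g] by simp
qed

lemma
  assumes "\<phi> \<in> gen_multipliers T"
  shows gen_multipliers_extensional: "\<phi> n \<in> extensional E"
    and gen_multipliers_closed: "x \<in> E \<Longrightarrow> \<phi> n x \<in> E"
    and gen_multipliers_add: "x \<in> E \<Longrightarrow> y \<in> E \<Longrightarrow> \<phi> n (x + y) = \<phi> n x + \<phi> n y"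
    and gen_multipliers_scaleC: "x \<in> E \<Longrightarrow> \<phi> n (c *\<^sub>C x) = c *\<^sub>C \<phi> n x"
    and gen_multipliers_bounded: "\<exists>K. \<forall>x\<in>E. norm (\<phi> n x) \<le> K * norm x"
  using assms unfolding gen_multipliers_iff bounded_ops_on_def by (auto simp: PiE_def)

lemma gen_multipliers_zero [simp]: "\<phi> \<in> gen_multipliers T \<Longrightarrow> \<phi> n 0 = 0"
  using gen_multipliers_scaleC[of \<phi> 0 n 0] by simp

lemma gen_multipliers_diff:
  assumes "\<phi> \<in> gen_multipliers T" "x \<in> E" "y \<in> E"
  shows "\<phi> n (x - y) = \<phi> n x - \<phi> n y"
  using gen_multipliers_add[OF assms(1) E_diff[OF assms(2,3)] assms(3), of n] by simp

lemma gen_multipliers_sum: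
  assumes "\<phi> \<in> gen_multipliers T" "\<And>i. i \<in> I \<Longrightarrow> f i \<in> E"
  shows "\<phi> n (\<Sum>i\<in>I. f i) = (\<Sum>i\<in>I. \<phi> n (f i))"
  using assms(2)
proof (induction I rule: infinite_finite_induct)
  case (insert i I)
  then show ?case by (simp add: gen_multipliers_add[OF assms(1)] E_sum)
qed (simp_all add: assms(1))

lemma gen_multipliers_tendsto:
  assumes \<phi>: "\<phi> \<in> gen_multipliers T" and X: "\<And>i. X i \<in> E" "l \<in> E" and lim: "(X \<longlongrightarrow> l) F"
  shows "((\<lambda>i. \<phi> n (X i)) \<longlongrightarrow> \<phi> n l) F"
proof -
  obtain K where K: "\<forall>x\<in>E. norm (\<phi> n x) \<le> K * norm x" using gen_multipliers_bounded[OF \<phi>] by blast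
  have "((\<lambda>i. K * norm (X i - l)) \<longlongrightarrow> 0) F"
    using lim by (intro tendsto_mult_right_zero tendsto_norm_zero LIM_zero)
  then have "((\<lambda>i. \<phi> n (X i) - \<phi> n l) \<longlongrightarrow> 0) F"
    by (rule Lim_null_comparison[rotated])
      (use K X in \<open>auto simp: gen_multipliers_diff[OF \<phi>, symmetric] E_diff intro!: always_eventually\<close>)
  then show ?thesis by (rule LIM_zero_cancel)
qed

text \<open>The coefficients of e are e, 0, 0, and so on, so only the term \<open>k = n\<close>
  survives. Assuming just \<open>\<phi> n 0 = 0\<close> allows its use before \<phi> is known to be
  a multiplier.\<close>

lemma conv_vec_defect:
  assumes "\<And>n. \<phi> n 0 = 0" "e \<in> E"
  shows "conv_vec \<phi> (coef e) n = \<phi> n e"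
proof -
  have "conv_vec \<phi> (coef e) n = (\<Sum>k\<le>n. if k = n then \<phi> n e else 0)"
    unfolding conv_vec_def by (rule sum.cong) (auto simp: coef_E assms)
  then show ?thesis by simp
qed

text \<open>Boundedness of \<open>\<phi> n\<close> is automatic, since \<open>\<phi> n e = coef (N e) n\<close> on the defect space.\<close>

lemma gen_multiplierI:
  assumes ext: "\<And>n. \<phi> n \<in> extensional E" and zero: "\<And>n. \<phi> n 0 = 0"
    and N: "bounded_clinear N" and coefs: "\<And>f. coef (N f) = conv_vec \<phi> (coef f)"
  shows "\<phi> \<in> gen_multipliers T" "mult_on_H \<phi> = N"
proof -
  have "\<phi> n \<in> bounded_ops_on E" for n
  proof -
    have eq: "\<phi> n e = coef (N e) n" if "e \<in> E" for e
      using coefs conv_vec_defect[of \<phi> e n] zero that by simp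
    have B: "bounded_clinear (\<lambda>x. coef (N x) n)"
      by (rule bounded_clinear_compose[OF bounded_clinear_coef N])
    interpret B: bounded_linear "\<lambda>x. coef (N x) n"
      by (rule bounded_clinear_imp_bounded_linear[OF B])
    obtain K where "\<And>x. norm (coef (N x) n) \<le> norm x * K" using B.bounded by blast
    then show ?thesis
      unfolding bounded_ops_on_def using ext[of n] bounded_clinear_scaleC[OF B]
      by (auto simp: PiE_def eq E_add E_scaleC B.add mult.commute intro!: exI[of _ K])
  qed
  then show "\<phi> \<in> gen_multipliers T" using coefs by (auto simp: gen_multipliers_iff)
  show "mult_on_H \<phi> = N" by (rule HOL.ext, rule mult_on_H_eqI, rule coefs)
qed

lemma mult_on_H_bounded_clinear:
  assumes \<phi>: "\<phi> \<in> gen_multipliers T"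
  shows "bounded_clinear (mult_on_H \<phi>)"
proof (rule bounded_clinearI)
  have add: "mult_on_H \<phi> (f + g) = mult_on_H \<phi> f + mult_on_H \<phi> g" for f g
    by (rule mult_on_H_eqI, rule HOL.ext)
      (simp add: coef_add coef_mult_on_H[OF \<phi>], simp add: conv_vec_def coef_add gen_multipliers_add[OF \<phi>] sum.distrib)
  show scale: "mult_on_H \<phi> (c *\<^sub>C f) = c *\<^sub>C mult_on_H \<phi> f" for c f
    by (rule mult_on_H_eqI, rule HOL.ext)
      (simp add: coef_scaleC coef_mult_on_H[OF \<phi>], simp add: conv_vec_def coef_scaleC gen_multipliers_scaleC[OF \<phi>] scaleC_sum_right)
  show "bounded_linear (mult_on_H \<phi>)"
  proof (rule closed_graph_theorem)
    show "linear (mult_on_H \<phi>)" by (rule linearI) (simp_all add: add scaleR_scaleC scale)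
    fix X x y assume X: "X \<longlonglongrightarrow> x" and Y: "(\<lambda>n. mult_on_H \<phi> (X n)) \<longlonglongrightarrow> y"
    show "mult_on_H \<phi> x = y"
    proof (rule mult_on_H_eqI, rule HOL.ext)
      fix n
      \<comment> \<open>For fixed n the convolution is a finite sum of continuous functions of X, so
        it passes to the limit.\<close>
      have "(\<lambda>i. conv_vec \<phi> (coef (X i)) n) \<longlonglongrightarrow> conv_vec \<phi> (coef x) n"
        unfolding conv_vec_def
        by (intro tendsto_sum gen_multipliers_tendsto[OF \<phi>] tendsto_coef X) simp_all
      then have "(\<lambda>i. coef (mult_on_H \<phi> (X i)) n) \<longlonglongrightarrow> conv_vec \<phi> (coef x) n"
        by (simp add: coef_mult_on_H[OF \<phi>])
      then show "coef y n = conv_vec \<phi> (coef x) n"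
        by (rule LIMSEQ_unique[OF tendsto_coef[OF Y]])
    qed
  qed
qed

lemmas mult_on_H_bounded_linear = bounded_clinear_imp_bounded_linear[OF mult_on_H_bounded_clinear]

lemma gen_multiplier_eq_coef:
  assumes "\<phi> \<in> gen_multipliers T" "e \<in> E"
  shows "\<phi> n e = coef (mult_on_H \<phi> e) n"
  using conv_vec_defect[of \<phi> e n] assms by (simp add: coef_mult_on_H)

lemma mult_on_H_inject:
  assumes "\<phi> \<in> gen_multipliers T" "\<psi> \<in> gen_multipliers T"
  shows "mult_on_H \<phi> = mult_on_H \<psi> \<longleftrightarrow> \<phi> = \<psi>"
proof
  assume eq: "mult_on_H \<phi> = mult_on_H \<psi>"
  show "\<phi> = \<psi>"
  proof
    fix n show "\<phi> n = \<psi> n"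
      by (rule extensionalityI[OF gen_multipliers_extensional[OF assms(1)] gen_multipliers_extensional[OF assms(2)]])
        (simp add: gen_multiplier_eq_coef assms eq)
  qed
qed simp

text \<open>The model map is isometric onto the model space and so carries unit ball onto unit
  ball.\<close>

lemma multiplier_norm_eq_onorm:
  assumes \<phi>: "\<phi> \<in> gen_multipliers T"
  shows "multiplier_norm T \<phi> = onorm (mult_on_H \<phi>)"
proof -
  have "{F \<in> model_space T. model_norm T F \<le> 1} = U ` {f. norm f \<le> 1}"
    by (auto simp: model_space_def)
  then show ?thesis
    unfolding multiplier_norm_def onorm_eq_SUP_unit_ball[OF mult_on_H_bounded_linear[OF \<phi>]]
    by (simp add: image_image mult_op_model_map[OF \<phi>])
qed

lemma mult_on_H_T:
  assumes \<phi>: "\<phi> \<in> gen_multipliers T"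
  shows "mult_on_H \<phi> (T f) = T (mult_on_H \<phi> f)"
proof (rule mult_on_H_eqI, rule HOL.ext)
  fix n
  show "coef (T (mult_on_H \<phi> f)) n = conv_vec \<phi> (coef (T f)) n"
  proof (cases n)
    case (Suc m)
    \<comment> \<open>The sum stops at m because the term with \<open>k = Suc m\<close> contains
      \<open>coef (T f) 0\<close>, which is 0.\<close>
    have "(\<Sum>k\<le>m. \<phi> k (coef (T f) (Suc m - k))) = (\<Sum>k\<le>m. \<phi> k (coef f (m - k)))"
      by (rule sum.cong) (simp_all add: coef_T Suc_diff_le)
    then show ?thesis using Suc
      by (simp add: coef_T coef_mult_on_H[OF \<phi>] conv_vec_def \<phi>)
  qed (simp add: coef_T conv_vec_def \<phi>)
qed

section \<open>Operations on multipliers and their operators\<close>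

lemma chi_id_multiplier:
  "chi_id T n \<in> gen_multipliers T" "mult_on_H (chi_id T n) = T ^^ n"
proof -
  have "coef ((T ^^ n) f) m = conv_vec (chi_id T n) (coef f) m" for f m
  proof -
    have "conv_vec (chi_id T n) (coef f) m = (\<Sum>k\<le>m. if k = n then coef f (m - n) else 0)"
      unfolding conv_vec_def chi_id_def by (rule sum.cong) auto
    then show ?thesis by (simp add: coef_funpow_T)
  qed
  then have "coef ((T ^^ n) f) = conv_vec (chi_id T n) (coef f)" for f by (rule HOL.ext)
  from gen_multiplierI[OF _ _ bounded_clinear_funpow[OF bounded] this]
  show "chi_id T n \<in> gen_multipliers T" "mult_on_H (chi_id T n) = T ^^ n"
    by (simp_all add: chi_id_def)
qed

lemma conv_op_multiplier:
  assumes \<phi>: "\<phi> \<in> gen_multipliers T" and \<psi>: "\<psi> \<in> gen_multipliers T"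
  shows "conv_op T \<phi> \<psi> \<in> gen_multipliers T"
    "mult_on_H (conv_op T \<phi> \<psi>) = (\<lambda>f. mult_on_H \<phi> (mult_on_H \<psi> f))"
proof -
  have "coef (mult_on_H \<phi> (mult_on_H \<psi> f)) n = conv_vec (conv_op T \<phi> \<psi>) (coef f) n" for f n
  proof -
    \<comment> \<open>Associativity of the Cauchy product: additivity of \<open>\<phi> j\<close> on
      \<open>E\<close> moves it inside the inner sum, and the triangular double sum is then
      regrouped by the total index of \<phi> and \<psi>.\<close>
    have "conv_vec \<phi> (conv_vec \<psi> (coef f)) n
        = (\<Sum>j=0..n. \<Sum>i=0..n-j. \<phi> j (\<psi> i (coef f (n - j - i))))"
      by (simp add: conv_vec_def gen_multipliers_sum[OF \<phi>] gen_multipliers_closed[OF \<psi>] atLeast0AtMost)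
    also have "\<dots> = (\<Sum>j=0..n. \<Sum>i=0..j. \<phi> i (\<psi> (j - i) (coef f (n - j))))"
      by (rule fps_mult_assoc_lemma[symmetric])
    also have "\<dots> = conv_vec (conv_op T \<phi> \<psi>) (coef f) n"
      by (simp add: conv_vec_def conv_op_def atLeast0AtMost)
    finally show ?thesis by (simp add: coef_mult_on_H \<phi> \<psi>)
  qed
  then have "coef (mult_on_H \<phi> (mult_on_H \<psi> f)) = conv_vec (conv_op T \<phi> \<psi>) (coef f)" for f
    by (rule HOL.ext)
  from gen_multiplierI[OF _ _ bounded_clinear_compose[OF mult_on_H_bounded_clinear[OF \<phi>] mult_on_H_bounded_clinear[OF \<psi>]] this]
  show "conv_op T \<phi> \<psi> \<in> gen_multipliers T"
    "mult_on_H (conv_op T \<phi> \<psi>) = (\<lambda>f. mult_on_H \<phi> (mult_on_H \<psi> f))"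
    by (simp_all add: conv_op_def \<phi> \<psi>)
qed

lemma add_multiplier:
  assumes \<phi>: "\<phi> \<in> gen_multipliers T" and \<psi>: "\<psi> \<in> gen_multipliers T"
  defines "\<theta> \<equiv> \<lambda>n. \<lambda>x\<in>E. \<phi> n x + \<psi> n x"
  shows "\<theta> \<in> gen_multipliers T" "mult_on_H \<theta> = (\<lambda>f. mult_on_H \<phi> f + mult_on_H \<psi> f)"
proof -
  have N: "bounded_clinear (\<lambda>f. mult_on_H \<phi> f + mult_on_H \<psi> f)"
    by (intro bounded_clinearI bounded_linear_add mult_on_H_bounded_linear \<phi> \<psi>)
      (simp add: bounded_clinear_scaleC[OF mult_on_H_bounded_clinear] \<phi> \<psi> scaleC_add_right)
  have "coef (mult_on_H \<phi> f + mult_on_H \<psi> f) = conv_vec \<theta> (coef f)" for f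
    by (rule HOL.ext) (simp add: coef_add coef_mult_on_H \<phi> \<psi>, simp add: conv_vec_def \<theta>_def sum.distrib)
  from gen_multiplierI[OF _ _ N this]
  show "\<theta> \<in> gen_multipliers T" "mult_on_H \<theta> = (\<lambda>f. mult_on_H \<phi> f + mult_on_H \<psi> f)"
    by (simp_all add: \<theta>_def \<phi> \<psi>)
qed

lemma smult_multiplier:
  fixes c :: complex
  assumes \<phi>: "\<phi> \<in> gen_multipliers T"
  defines "\<theta> \<equiv> \<lambda>n. \<lambda>x\<in>E. c *\<^sub>C \<phi> n x"
  shows "\<theta> \<in> gen_multipliers T" "mult_on_H \<theta> = (\<lambda>f. c *\<^sub>C mult_on_H \<phi> f)"
proof -
  have N: "bounded_clinear (\<lambda>f. c *\<^sub>C mult_on_H \<phi> f)"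
    by (rule bounded_clinear_compose[OF _ mult_on_H_bounded_clinear[OF \<phi>]])
      (intro bounded_clinearI bounded_linear_scaleC_right, simp add: scaleC_scaleC mult.commute)
  have "coef (c *\<^sub>C mult_on_H \<phi> f) = conv_vec \<theta> (coef f)" for f
    by (rule HOL.ext) (simp add: coef_scaleC coef_mult_on_H \<phi>, simp add: conv_vec_def \<theta>_def scaleC_sum_right)
  from gen_multiplierI[OF _ _ N this]
  show "\<theta> \<in> gen_multipliers T" "mult_on_H \<theta> = (\<lambda>f. c *\<^sub>C mult_on_H \<phi> f)"
    by (simp_all add: \<theta>_def \<phi>)
qed

lemma zero_multiplier:
  "(\<lambda>n. \<lambda>x\<in>E. 0) \<in> gen_multipliers T" "mult_on_H (\<lambda>n. \<lambda>x\<in>E. 0) = (\<lambda>f. 0)"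
proof -
  have "coef 0 = conv_vec (\<lambda>n. \<lambda>x\<in>E. 0) (coef f)" for f
    by (rule HOL.ext) (simp add: conv_vec_def)
  from gen_multiplierI[OF _ _ _ this]
  show "(\<lambda>n. \<lambda>x\<in>E. 0) \<in> gen_multipliers T" "mult_on_H (\<lambda>n. \<lambda>x\<in>E. 0) = (\<lambda>f. 0)"
    by (simp_all add: bounded_clinear_def)
qed

text \<open>Bounded operators form a complete space, and each coefficient of a product involves
  finitely many terms, so limits pass through the convolution. Convergence of the coefficients is
  recorded as well, since it shows that a subspace defined by conditions on the coefficients is
  closed.\<close>

lemma gen_multipliers_complete:
  assumes s: "\<And>n. s n \<in> gen_multipliers T"
    and Cauchy: "\<And>e. 0 < e \<Longrightarrow> \<exists>n0. \<forall>m\<ge>n0. \<forall>n\<ge>n0. onorm (\<lambda>f. mult_on_H (s m) f - mult_on_H (s n) f) < e"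
  obtains \<phi> where "\<phi> \<in> gen_multipliers T"
    "(\<lambda>n. onorm (\<lambda>f. mult_on_H (s n) f - mult_on_H \<phi> f)) \<longlonglongrightarrow> 0"
    "\<And>n e. e \<in> E \<Longrightarrow> (\<lambda>m. s m n e) \<longlonglongrightarrow> \<phi> n e"
proof -
  define B where "B n = Blinfun (mult_on_H (s n))" for n
  have B: "blinfun_apply (B n) = mult_on_H (s n)" for n
    unfolding B_def by (rule bounded_linear_Blinfun_apply[OF mult_on_H_bounded_linear[OF s]])
  have "Cauchy B"
    by (rule CauchyI) (use Cauchy in \<open>simp add: norm_blinfun.rep_eq blinfun.diff_left B minus_blinfun.rep_eq\<close>)
  then obtain N where lim: "B \<longlonglongrightarrow> N" using Cauchy_convergent convergent_def by blast
  have pt: "(\<lambda>m. mult_on_H (s m) f) \<longlonglongrightarrow> blinfun_apply N f" for f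
    using blinfun.tendsto[OF lim tendsto_const, of f] by (simp add: B)
  have "(\<lambda>m. mult_on_H (s m) (c *\<^sub>C f)) \<longlonglongrightarrow> c *\<^sub>C blinfun_apply N f" for c f
    using tendsto_scaleC_right[OF pt, of c f]
    by (simp add: bounded_clinear_scaleC[OF mult_on_H_bounded_clinear[OF s]])
  then have N: "bounded_clinear (blinfun_apply N)"
    using LIMSEQ_unique[OF pt] by (intro bounded_clinearI blinfun.bounded_linear_right) blast
  define \<phi> where "\<phi> n = (\<lambda>e\<in>E. coef (blinfun_apply N e) n)" for n
  have lim_ops: "(\<lambda>m. s m n e) \<longlonglongrightarrow> \<phi> n e" if "e \<in> E" for n e
    using tendsto_coef[OF pt, of e n] that by (simp add: \<phi>_def gen_multiplier_eq_coef[OF s])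
  have "coef (blinfun_apply N f) n = conv_vec \<phi> (coef f) n" for f n
  proof (rule LIMSEQ_unique[OF tendsto_coef[OF pt]])
    have "(\<lambda>m. conv_vec (s m) (coef f) n) \<longlonglongrightarrow> conv_vec \<phi> (coef f) n"
      unfolding conv_vec_def by (intro tendsto_sum lim_ops) simp
    then show "(\<lambda>m. coef (mult_on_H (s m) f) n) \<longlonglongrightarrow> conv_vec \<phi> (coef f) n"
      by (simp add: coef_mult_on_H[OF s])
  qed
  then have "coef (blinfun_apply N f) = conv_vec \<phi> (coef f)" for f by (rule HOL.ext)
  from gen_multiplierI[OF _ _ N this]
  have \<phi>: "\<phi> \<in> gen_multipliers T" "mult_on_H \<phi> = blinfun_apply N"
    by (simp_all add: \<phi>_def blinfun.zero_right)
  have "(\<lambda>n. norm (B n - N)) \<longlonglongrightarrow> 0" using lim by (intro tendsto_norm_zero LIM_zero)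
  then have "(\<lambda>n. onorm (\<lambda>f. mult_on_H (s n) f - mult_on_H \<phi> f)) \<longlonglongrightarrow> 0"
    by (simp add: norm_blinfun.rep_eq minus_blinfun.rep_eq B \<phi>(2))
  then show thesis using that \<phi>(1) lim_ops by blast
qed

end


subsection \<open>The Banach algebras of multipliers\<close>

lemma cring_complex_ring: "cring complex_ring"
proof (rule cringI)
  show "abelian_group complex_ring"
  proof (rule abelian_groupI)
    fix x assume "x \<in> carrier complex_ring"
    show "\<exists>y\<in>carrier complex_ring. y \<oplus>\<^bsub>complex_ring\<^esub> x = \<zero>\<^bsub>complex_ring\<^esub>"
      by (rule bexI[of _ "- x"]) (simp_all add: complex_ring_def)
  qed (simp_all add: complex_ring_def)
  show "comm_monoid complex_ring" by (rule comm_monoidI) (simp_all add: complex_ring_def)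
qed (simp add: complex_ring_def distrib_right)

context left_invertible_analytic
begin

text \<open>Stated for a subset S so that it serves both algebras. Completeness is the one axiom
  that asks more of S than algebraic closure, namely closure under pointwise limits of
  coefficients.\<close>

lemma multiplier_algebra_banach:
  assumes S: "S \<subseteq> gen_multipliers T"
    and one: "chi_id T 0 \<in> S" and zero: "(\<lambda>n. \<lambda>x\<in>E. 0) \<in> S"
    and add: "\<And>\<phi> \<psi>. \<phi> \<in> S \<Longrightarrow> \<psi> \<in> S \<Longrightarrow> (\<lambda>n. \<lambda>x\<in>E. \<phi> n x + \<psi> n x) \<in> S"
    and smult: "\<And>c \<phi>. \<phi> \<in> S \<Longrightarrow> (\<lambda>n. \<lambda>x\<in>E. c *\<^sub>C \<phi> n x) \<in> S"
    and mult: "\<And>\<phi> \<psi>. \<phi> \<in> S \<Longrightarrow> \<psi> \<in> S \<Longrightarrow> conv_op T \<phi> \<psi> \<in> S"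
    and closed: "\<And>s \<phi>. range s \<subseteq> S \<Longrightarrow> \<phi> \<in> gen_multipliers T \<Longrightarrow>
      (\<And>n e. e \<in> E \<Longrightarrow> (\<lambda>m. s m n e) \<longlonglongrightarrow> \<phi> n e) \<Longrightarrow> \<phi> \<in> S"
  shows "unital_banach_algebra (multiplier_algebra T S) (multiplier_norm T)"
proof -
  let ?A = "multiplier_algebra T S"
  let ?M = mult_on_H
  have carr [simp]: "carrier ?A = S" by (simp add: multiplier_algebra_def)
  have GM: "\<phi> \<in> gen_multipliers T" if "\<phi> \<in> S" for \<phi> using S that by blast
  have closed_add: "\<phi> \<oplus>\<^bsub>?A\<^esub> \<psi> \<in> S" and M_add: "?M (\<phi> \<oplus>\<^bsub>?A\<^esub> \<psi>) = (\<lambda>f. ?M \<phi> f + ?M \<psi> f)"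
    if "\<phi> \<in> S" "\<psi> \<in> S" for \<phi> \<psi>
    using add[OF that] add_multiplier(2)[OF GM GM, OF that] by (simp_all add: multiplier_algebra_def)
  have closed_smult: "c \<odot>\<^bsub>?A\<^esub> \<phi> \<in> S" and M_smult: "?M (c \<odot>\<^bsub>?A\<^esub> \<phi>) = (\<lambda>f. c *\<^sub>C ?M \<phi> f)"
    if "\<phi> \<in> S" for c \<phi>
    using smult[OF that] smult_multiplier(2)[OF GM, OF that] by (simp_all add: multiplier_algebra_def)
  have closed_mult: "\<phi> \<otimes>\<^bsub>?A\<^esub> \<psi> \<in> S" and M_mult: "?M (\<phi> \<otimes>\<^bsub>?A\<^esub> \<psi>) = (\<lambda>f. ?M \<phi> (?M \<psi> f))"
    if "\<phi> \<in> S" "\<psi> \<in> S" for \<phi> \<psi>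
    using mult[OF that] conv_op_multiplier(2)[OF GM GM, OF that] by (simp_all add: multiplier_algebra_def)
  have closed_one: "\<one>\<^bsub>?A\<^esub> \<in> S" and M_one: "?M \<one>\<^bsub>?A\<^esub> = (\<lambda>f. f)"
    using one chi_id_multiplier(2)[of 0] by (simp_all add: multiplier_algebra_def id_def)
  have closed_zero: "\<zero>\<^bsub>?A\<^esub> \<in> S" and M_zero: "?M \<zero>\<^bsub>?A\<^esub> = (\<lambda>f. 0)"
    using zero zero_multiplier(2) by (simp_all add: multiplier_algebra_def)
  note clo = closed_add closed_smult closed_mult closed_one closed_zero
  note hom = M_add M_smult M_mult M_one M_zero
  have M_lin: "?M \<phi> (f + g) = ?M \<phi> f + ?M \<phi> g" "?M \<phi> (c *\<^sub>C f) = c *\<^sub>C ?M \<phi> f" if "\<phi> \<in> S" for \<phi> f g c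
    using linear_simps(1)[OF mult_on_H_bounded_linear[OF GM[OF that]]]
      bounded_clinear_scaleC[OF mult_on_H_bounded_clinear[OF GM[OF that]]] by auto
  have eqI: "\<phi> = \<psi>" if "\<phi> \<in> S" "\<psi> \<in> S" "\<And>f. ?M \<phi> f = ?M \<psi> f" for \<phi> \<psi>
    using mult_on_H_inject[OF GM GM, OF that(1,2)] that(3) by blast
  have abelian: "abelian_group ?A"
  proof (rule abelian_groupI, unfold carr)
    fix x assume x: "x \<in> S"
    show "\<exists>y\<in>S. y \<oplus>\<^bsub>?A\<^esub> x = \<zero>\<^bsub>?A\<^esub>"
    proof (rule bexI[of _ "(- 1) \<odot>\<^bsub>?A\<^esub> x"])
      show "((- 1) \<odot>\<^bsub>?A\<^esub> x) \<oplus>\<^bsub>?A\<^esub> x = \<zero>\<^bsub>?A\<^esub>"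
        by (rule eqI) (simp_all add: clo hom x scaleC_minus_left scaleC_one)
    qed (rule closed_smult[OF x])
  \<comment> \<open>\<open>eqI\<close> turns an equation between sequences into one between the
    operators at each f, which the rules \<open>hom\<close> evaluate.\<close>
  qed (rule eqI | simp add: clo hom add_ac)+
  have ring: "Ring.ring ?A"
  proof (rule ringI[OF abelian])
    show "monoid ?A"
      by (rule monoidI, unfold carr) (rule eqI | simp add: clo hom)+
  qed (unfold carr, (rule eqI | simp add: clo hom M_lin)+)
  have module: "Module.module complex_ring ?A"
    by (rule moduleI[OF cring_complex_ring abelian], unfold carr)
      (rule eqI | simp add: clo hom M_lin complex_ring_def scaleC_add_left scaleC_add_right scaleC_scaleC scaleC_one)+
  interpret A: ring ?A by (rule ring)
  have closed_diff: "x \<ominus>\<^bsub>?A\<^esub> y \<in> S" if "x \<in> S" "y \<in> S" for x y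
    using A.minus_closed that by simp
  \<comment> \<open>Subtraction in the algebra uses the abstract additive inverse, for which no
    formula is given; its operator is obtained from the identity
    \<open>(x - y) + y = x\<close>.\<close>
  have M_diff: "?M (x \<ominus>\<^bsub>?A\<^esub> y) = (\<lambda>f. ?M x f - ?M y f)" if x: "x \<in> S" and y: "y \<in> S" for x y
  proof
    fix f
    have "(x \<ominus>\<^bsub>?A\<^esub> y) \<oplus>\<^bsub>?A\<^esub> y = x"
      using A.a_assoc[of x "\<ominus>\<^bsub>?A\<^esub> y" y] A.a_inv_closed[of y] A.l_neg[of y] A.r_zero[of x] x y
      by (simp add: a_minus_def)
    then have "?M x f = ?M (x \<ominus>\<^bsub>?A\<^esub> y) f + ?M y f"
      using M_add[OF closed_diff[OF x y] y] by simp
    then show "?M (x \<ominus>\<^bsub>?A\<^esub> y) f = ?M x f - ?M y f" by simp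
  qed
  have N: "multiplier_norm T x = onorm (?M x)" if "x \<in> S" for x
    by (rule multiplier_norm_eq_onorm[OF GM[OF that]])
  have bl: "bounded_linear (?M x)" if "x \<in> S" for x by (rule mult_on_H_bounded_linear[OF GM[OF that]])
  have smult_le: "onorm (\<lambda>f. c *\<^sub>C ?M x f) \<le> cmod c * onorm (?M x)" if "x \<in> S" for c x
    by (rule onorm_bound)
      (simp_all add: norm_scaleC mult.assoc mult_left_mono onorm[OF bl[OF that]] onorm_pos_le[OF bl[OF that]])
  have norm_smult: "multiplier_norm T (c \<odot>\<^bsub>?A\<^esub> x) = cmod c * multiplier_norm T x" if x: "x \<in> S" for c x
  proof (cases "c = 0")
    case True
    then show ?thesis using x by (simp add: N clo hom onorm_zero)
  next
    case False
    have cx: "c \<odot>\<^bsub>?A\<^esub> x \<in> S" by (rule closed_smult[OF x])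
    \<comment> \<open>The reverse inequality comes from the estimate for \<open>inverse c\<close>,
      applied to the multiple of x by c.\<close>
    have "onorm (?M x) \<le> cmod (inverse c) * onorm (?M (c \<odot>\<^bsub>?A\<^esub> x))"
      using smult_le[OF cx, of "inverse c"] False by (simp add: M_smult[OF x] scaleC_scaleC scaleC_one)
    then have "cmod c * onorm (?M x) \<le> onorm (?M (c \<odot>\<^bsub>?A\<^esub> x))"
      using False by (simp add: norm_divide field_simps)
    then show ?thesis using smult_le[OF x, of c] by (simp add: N[OF x] N[OF cx] M_smult[OF x])
  qed
  \<comment> \<open>The lower bound comes from a nonzero vector of H; on the zero space the identity
    would have norm 0.\<close>
  have norm_one: "onorm (\<lambda>f::'a. f) = 1"
  proof (rule antisym[OF onorm_id_le])
    obtain x :: 'a where "x \<noteq> 0" using nonzero by blast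
    then show "1 \<le> onorm (\<lambda>f::'a. f)" using onorm[OF bounded_linear_ident, of x] by simp
  qed
  have complete: "\<exists>x\<in>S. (\<lambda>n. multiplier_norm T (s n \<ominus>\<^bsub>?A\<^esub> x)) \<longlonglongrightarrow> 0"
    if s: "range s \<subseteq> S" and Cauchy: "\<forall>e>0. \<exists>n0. \<forall>m\<ge>n0. \<forall>n\<ge>n0. multiplier_norm T (s m \<ominus>\<^bsub>?A\<^esub> s n) < e" for s
  proof -
    have sS: "s n \<in> S" for n using s by blast
    obtain \<phi> where \<phi>: "\<phi> \<in> gen_multipliers T"
      "(\<lambda>n. onorm (\<lambda>f. ?M (s n) f - ?M \<phi> f)) \<longlonglongrightarrow> 0"
      "\<And>n e. e \<in> E \<Longrightarrow> (\<lambda>m. s m n e) \<longlonglongrightarrow> \<phi> n e"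
      using gen_multipliers_complete[of s] Cauchy by (auto simp: N closed_diff M_diff sS GM)
    have "\<phi> \<in> S" by (rule closed[OF s \<phi>(1,3)])
    then show ?thesis using \<phi>(2) by (intro bexI[of _ \<phi>]) (simp_all add: N closed_diff M_diff sS)
  qed
  have zero_iff: "multiplier_norm T x = 0 \<longleftrightarrow> x = \<zero>\<^bsub>?A\<^esub>" if x: "x \<in> S" for x
    using eqI[OF x closed_zero] by (auto simp: N x closed_zero M_zero onorm_zero onorm_eq_0[OF bl[OF x]])
  show ?thesis
    unfolding unital_banach_algebra_def carr
  proof (intro conjI allI ballI impI module ring)
    fix c x y assume x: "x \<in> S" and y: "y \<in> S"
    show "(c \<odot>\<^bsub>?A\<^esub> x) \<otimes>\<^bsub>?A\<^esub> y = c \<odot>\<^bsub>?A\<^esub> (x \<otimes>\<^bsub>?A\<^esub> y)"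
      "x \<otimes>\<^bsub>?A\<^esub> (c \<odot>\<^bsub>?A\<^esub> y) = c \<odot>\<^bsub>?A\<^esub> (x \<otimes>\<^bsub>?A\<^esub> y)"
      by (rule eqI; simp add: clo hom M_lin x y)+
  next
    fix x y assume x: "x \<in> S" and y: "y \<in> S"
    show "multiplier_norm T (x \<oplus>\<^bsub>?A\<^esub> y) \<le> multiplier_norm T x + multiplier_norm T y"
      using onorm_triangle[OF bl[OF x] bl[OF y]] by (simp add: N x y clo hom)
    show "multiplier_norm T (x \<otimes>\<^bsub>?A\<^esub> y) \<le> multiplier_norm T x * multiplier_norm T y"
      using onorm_compose[OF bl[OF x] bl[OF y]] by (simp add: N x y clo hom comp_def)
  next
    fix x assume x: "x \<in> S"
    show "0 \<le> multiplier_norm T x" by (simp add: N x onorm_pos_le bl)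
    show "multiplier_norm T x = 0 \<longleftrightarrow> x = \<zero>\<^bsub>?A\<^esub>" by (rule zero_iff[OF x])
    show "multiplier_norm T (c \<odot>\<^bsub>?A\<^esub> x) = cmod c * multiplier_norm T x" for c by (rule norm_smult[OF x])
  next
    show "multiplier_norm T \<one>\<^bsub>?A\<^esub> = 1" by (simp add: N clo hom norm_one)
  qed (use complete in blast)
qed

lemma gen_multipliers_banach:
  "unital_banach_algebra (multiplier_algebra T (gen_multipliers T)) (multiplier_norm T)"
  by (rule multiplier_algebra_banach)
    (simp_all add: chi_id_multiplier zero_multiplier add_multiplier smult_multiplier conv_op_multiplier)

section \<open>Multipliers with scalar coefficients\<close>

lemma scalar_multiplierI:
  assumes "\<phi> \<in> gen_multipliers T" "\<And>n x. x \<in> E \<Longrightarrow> \<phi> n x = a n *\<^sub>C x"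
  shows "\<phi> \<in> scalar_multipliers T"
proof -
  have "\<phi> n = (\<lambda>x\<in>E. a n *\<^sub>C x)" for n
    by (rule extensionalityI[OF gen_multipliers_extensional[OF assms(1)]]) (simp_all add: assms(2))
  then show ?thesis using assms(1) by (auto simp: scalar_multipliers_def)
qed

lemma scalar_multiplierE:
  assumes "\<phi> \<in> scalar_multipliers T"
  obtains a where "\<phi> \<in> gen_multipliers T" "\<And>n x. x \<in> E \<Longrightarrow> \<phi> n x = a n *\<^sub>C x"
proof -
  have "\<forall>n. \<exists>c. \<phi> n = (\<lambda>x\<in>E. c *\<^sub>C x)" using assms by (simp add: scalar_multipliers_def)
  then obtain a where "\<And>n. \<phi> n = (\<lambda>x\<in>E. a n *\<^sub>C x)" by metis
  then show thesis using that[of a] assms by (simp add: scalar_multipliers_def)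
qed

lemma scaleC_sum_left: "(\<Sum>i\<in>I. a i) *\<^sub>C x = (\<Sum>i\<in>I. a i *\<^sub>C (x::'a))"
  using bounded_linear_scaleC_left by (rule linear_sum[OF bounded_linear.linear])

lemma conv_op_scalar:
  assumes "x \<in> E" "\<And>n x. x \<in> E \<Longrightarrow> \<phi> n x = a n *\<^sub>C x" "\<And>n x. x \<in> E \<Longrightarrow> \<psi> n x = b n *\<^sub>C x"
  shows "conv_op T \<phi> \<psi> n x = (\<Sum>j\<le>n. a j * b (n - j)) *\<^sub>C x"
  using assms by (simp add: conv_op_def E_scaleC scaleC_scaleC scaleC_sum_left)

text \<open>On \<open>E\<close> both sides are multiples of the identity by the same Cauchy product
  of scalar sequences; off \<open>E\<close> both are \<open>undefined\<close>.\<close>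

lemma scalar_multipliers_commute:
  assumes "\<phi> \<in> scalar_multipliers T" "\<psi> \<in> scalar_multipliers T"
  shows "conv_op T \<phi> \<psi> = conv_op T \<psi> \<phi>"
proof (intro HOL.ext)
  obtain a where a: "\<And>n x. x \<in> E \<Longrightarrow> \<phi> n x = a n *\<^sub>C x" using scalar_multiplierE[OF assms(1)] by metis
  obtain b where b: "\<And>n x. x \<in> E \<Longrightarrow> \<psi> n x = b n *\<^sub>C x" using scalar_multiplierE[OF assms(2)] by metis
  fix n x
  have "(\<Sum>j\<le>n. a j * b (n - j)) = (\<Sum>j\<le>n. b j * a (n - j))"
    using fps_mult_commute_lemma[of "\<lambda>i j. a i * b j" n] by (simp add: atLeast0AtMost mult.commute)
  then show "conv_op T \<phi> \<psi> n x = conv_op T \<psi> \<phi> n x"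
    using conv_op_scalar[of x \<phi> a \<psi> b n] conv_op_scalar[of x \<psi> b \<phi> a n] a b
    by (cases "x \<in> E") (simp, simp add: conv_op_def)
qed

text \<open>A fixed nonzero e in \<open>E\<close> recovers the scalars by pairing with e and
  dividing by \<open>cinner e e\<close>. Convergence at e thus gives convergence of the scalars, and
  their limits determine the limit on every vector of \<open>E\<close>.\<close>

lemma scalar_multipliers_limit:
  assumes s: "range s \<subseteq> scalar_multipliers T" and \<phi>: "\<phi> \<in> gen_multipliers T"
    and lim: "\<And>n e. e \<in> E \<Longrightarrow> (\<lambda>m. s m n e) \<longlonglongrightarrow> \<phi> n e"
  shows "\<phi> \<in> scalar_multipliers T"
proof -
  have "\<exists>a. \<forall>n. \<forall>x\<in>E. s m n x = a n *\<^sub>C x" for m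
    using scalar_multiplierE[of "s m"] s by (metis range_subsetD)
  then obtain a where a: "\<And>m n x. x \<in> E \<Longrightarrow> s m n x = a m n *\<^sub>C x" by metis
  obtain e where e: "e \<in> E" "e \<noteq> 0" using E_nontrivial by blast
  have "\<exists>c. (\<lambda>m. a m n) \<longlonglongrightarrow> c" for n
  proof -
    have "(\<lambda>m. a m n * cinner e e) \<longlonglongrightarrow> cinner (\<phi> n e) e"
      using tendsto_cinner_left[OF lim[OF e(1)], of n e] by (simp add: a e(1) cinner_scaleC_left)
    from tendsto_divide[OF this tendsto_const, of "cinner e e"] show ?thesis using e(2) by auto
  qed
  then obtain c where c: "\<And>n. (\<lambda>m. a m n) \<longlonglongrightarrow> c n" by metis
  show ?thesis
  proof (rule scalar_multiplierI[OF \<phi>])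
    fix n x assume x: "x \<in> E"
    have "(\<lambda>m. s m n x) \<longlonglongrightarrow> c n *\<^sub>C x"
      using bounded_linear.tendsto[OF bounded_linear_scaleC_left c] by (simp add: a x)
    then show "\<phi> n x = c n *\<^sub>C x" by (rule LIMSEQ_unique[OF lim[OF x]])
  qed
qed

lemma scalar_multipliers_banach:
  "unital_banach_algebra (multiplier_algebra T (scalar_multipliers T)) (multiplier_norm T)"
proof (rule multiplier_algebra_banach)
  show "scalar_multipliers T \<subseteq> gen_multipliers T" by (auto simp: scalar_multipliers_def)
  show "chi_id T 0 \<in> scalar_multipliers T"
    by (rule scalar_multiplierI[OF chi_id_multiplier(1), where a = "\<lambda>n. if n = 0 then 1 else 0"])
      (simp add: chi_id_def scaleC_one)
  show "(\<lambda>n. \<lambda>x\<in>E. 0) \<in> scalar_multipliers T"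
    by (rule scalar_multiplierI[OF zero_multiplier(1), where a = "\<lambda>n. 0"]) simp
  fix \<phi> assume "\<phi> \<in> scalar_multipliers T"
  then obtain a where a: "\<phi> \<in> gen_multipliers T" "\<And>n x. x \<in> E \<Longrightarrow> \<phi> n x = a n *\<^sub>C x"
    by (rule scalar_multiplierE) blast
  show "(\<lambda>n. \<lambda>x\<in>E. c *\<^sub>C \<phi> n x) \<in> scalar_multipliers T" for c
    by (rule scalar_multiplierI[OF smult_multiplier(1)[OF a(1)], where a = "\<lambda>n. c * a n"])
      (simp add: a(2) scaleC_scaleC)
  fix \<psi> assume "\<psi> \<in> scalar_multipliers T"
  then obtain b where b: "\<psi> \<in> gen_multipliers T" "\<And>n x. x \<in> E \<Longrightarrow> \<psi> n x = b n *\<^sub>C x"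
    by (rule scalar_multiplierE) blast
  show "(\<lambda>n. \<lambda>x\<in>E. \<phi> n x + \<psi> n x) \<in> scalar_multipliers T"
    by (rule scalar_multiplierI[OF add_multiplier(1)[OF a(1) b(1)], where a = "\<lambda>n. a n + b n"])
      (simp add: a(2) b(2) scaleC_add_left)
  show "conv_op T \<phi> \<psi> \<in> scalar_multipliers T"
    by (rule scalar_multiplierI[OF conv_op_multiplier(1)[OF a(1) b(1)] conv_op_scalar[OF _ a(2) b(2)]])
qed (rule scalar_multipliers_limit)

end

theorem theorem2:
  fixes T :: "'a::chilbert_space \<Rightarrow> 'a"
  assumes nonzero: "\<exists>x::'a. x \<noteq> 0"
    and bounded: "bounded_clinear T"
    and left_inv: "left_invertible T"
    and analytic: "analytic_operator T"
  shows
    "(\<forall>n. chi_id T n \<in> gen_multipliers T \<and>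
        (\<forall>F\<in>model_space T. (model_operator T ^^ n) F = mult_op T (chi_id T n) F)) \<and>
     (\<forall>\<phi>\<in>gen_multipliers T. \<forall>F\<in>model_space T.
        mult_op T \<phi> (model_operator T F) = model_operator T (mult_op T \<phi> F)) \<and>
     (\<forall>\<phi>\<in>gen_multipliers T. \<forall>\<psi>\<in>gen_multipliers T.
        conv_op T \<phi> \<psi> \<in> gen_multipliers T \<and>
        (\<forall>F\<in>model_space T.
           mult_op T \<phi> (mult_op T \<psi> F) = mult_op T (conv_op T \<phi> \<psi>) F)) \<and>
     unital_banach_algebra (multiplier_algebra T (gen_multipliers T)) (multiplier_norm T) \<and>
     unital_banach_algebra (multiplier_algebra T (scalar_multipliers T)) (multiplier_norm T) \<and>
     (\<forall>\<phi>\<in>scalar_multipliers T. \<forall>\<psi>\<in>scalar_multipliers T.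
        conv_op T \<phi> \<psi> = conv_op T \<psi> \<phi>)"
proof -
  interpret left_invertible_analytic T by unfold_locales (rule assms)+
  show ?thesis
  proof (intro conjI allI ballI)
    fix n F assume "F \<in> model_space T"
    then obtain f where "F = model_map T f" by (auto simp: model_space_def)
    then show "(model_operator T ^^ n) F = mult_op T (chi_id T n) F"
      by (simp add: model_operator_funpow_model_map mult_op_model_map chi_id_multiplier)
  next
    fix \<phi> F assume \<phi>: "\<phi> \<in> gen_multipliers T" and "F \<in> model_space T"
    then obtain f where "F = model_map T f" by (auto simp: model_space_def)
    then show "mult_op T \<phi> (model_operator T F) = model_operator T (mult_op T \<phi> F)"
      by (simp add: mult_op_model_map \<phi> mult_on_H_T)
  next
    fix \<phi> \<psi> F assume \<phi>: "\<phi> \<in> gen_multipliers T" and \<psi>: "\<psi> \<in> gen_multipliers T" and "F \<in> model_space T"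
    then obtain f where "F = model_map T f" by (auto simp: model_space_def)
    then show "mult_op T \<phi> (mult_op T \<psi> F) = mult_op T (conv_op T \<phi> \<psi>) F"
      by (simp add: mult_op_model_map \<phi> \<psi> conv_op_multiplier)
  qed (simp_all add: chi_id_multiplier conv_op_multiplier gen_multipliers_banach
      scalar_multipliers_banach scalar_multipliers_commute)
qed

end
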